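(* Let $R$ be a Dedekind domain and let $I$ be a nonzero ideal of $R$ such that $R/I$ is finite and nontrivial. For any positive integer $m$, the number of cliques of order $m$ (sets of $m$ pairwise adjacent vertices) in the graph $G_{R/I}$ is \[\prod_{k=1}^m\frac{\mathcal{S}_{k-1}(R/I)}{k}.\]
   Context: For a commutative ring $X$ with unity, the unitary Cayley graph $G_X$ has vertex set $X$ and edge set $\{\{a,b\}: a-b\in U(X)\}$, where $U(X)$ is the unit group. For a nonnegative integer $r$ and nonzero ideals $I$ of $R$ with $R/I$ finite, $\mathcal{S}_r(R/I)$ is defined by: (a) $\mathcal{S}_r(R/R)=1$; (b) for a prime ideal $P$ of finite index and positive integer $\alpha$, $\mathcal{S}_r(R/P^\alpha)=|R/P|^{\alpha-1}(|R/P|-r)$ if $r\le |R/P|$ and $0$ if $r>|R/P|$; (c) $\mathcal{S}_r(R/AB)=\mathcal{S}_r(R/A)\mathcal{S}_r(R/B)$ for relatively prime nonzero ideals $A,B$ of finite index. *)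

theory Defs
  imports
    Complex_Main
    "HOL-Algebra.QuotRing"
    "HOL-Algebra.Ideal_Product"
    "HOL-Algebra.Polynomials"
begin

section \<open>Dedekind domains\<close>

text \<open>\<open>K\<close> is a field of fractions of \<open>R\<close> via the embedding \<open>h\<close>.\<close>

definition fraction_field_via ::
    "('a, 'm) ring_scheme \<Rightarrow> ('k, 'n) ring_scheme \<Rightarrow> ('a \<Rightarrow> 'k) \<Rightarrow> bool" where
  "fraction_field_via R K h \<longleftrightarrow>
     field K \<and> h \<in> ring_hom R K \<and> inj_on h (carrier R) \<and>
     (\<forall>x\<in>carrier K. \<exists>a\<in>carrier R. \<exists>b\<in>carrier R - {\<zero>\<^bsub>R\<^esub>}. x = h a \<otimes>\<^bsub>K\<^esub> inv\<^bsub>K\<^esub> (h b))"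

definition integral_over :: "('k, 'n) ring_scheme \<Rightarrow> 'k set \<Rightarrow> 'k \<Rightarrow> bool" where
  "integral_over K A x \<longleftrightarrow>
     (\<exists>p. polynomial\<^bsub>K\<^esub> A p \<and> p \<noteq> [] \<and> lead_coeff p = \<one>\<^bsub>K\<^esub> \<and> ring.eval K p x = \<zero>\<^bsub>K\<^esub>)"

text \<open>
  The field of fractions is unique up to isomorphism over \<open>R\<close>, so it does not matter which one
  is used. The type \<open>('a \<times> 'a) set\<close> always has room for one, since it holds the classes of
  pairs (numerator, denominator).
\<close>

definition integrally_closed :: "('a, 'm) ring_scheme \<Rightarrow> bool" where
  "integrally_closed R \<longleftrightarrow>
     (\<exists>(K :: ('a \<times> 'a) set ring) h. fraction_field_via R K h \<and>
        (\<forall>x\<in>carrier K. integral_over K (h ` carrier R) x \<longrightarrow> x \<in> h ` carrier R))"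

text \<open>Fields are not excluded.\<close>

locale dedekind_domain = noetherian_domain +
  assumes integrally_closed: "integrally_closed R"
    and nonzero_prime_maximal: "\<lbrakk> primeideal P R; P \<noteq> {\<zero>} \<rbrakk> \<Longrightarrow> maximalideal P R"


section \<open>Unitary Cayley graphs and cliques\<close>

text \<open>The vertex set of the unitary Cayley graph of \<open>S\<close> is \<^term>\<open>carrier S\<close>.\<close>

definition unitary_cayley_edges :: "('a, 'm) ring_scheme \<Rightarrow> 'a set set" where
  "unitary_cayley_edges S =
     {{a, b} | a b. a \<in> carrier S \<and> b \<in> carrier S \<and> a \<ominus>\<^bsub>S\<^esub> b \<in> Units S}"

definition cliques :: "'v set \<Rightarrow> 'v set set \<Rightarrow> nat \<Rightarrow> 'v set set" where
  "cliques V E m = {C. C \<subseteq> V \<and> finite C \<and> card C = m \<and> pairwise (\<lambda>a b. {a, b} \<in> E) C}"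


section \<open>The functions \<open>S\<^sub>r\<close>\<close>

text \<open>
  \<open>schemmel_rel R r I s\<close> says that the three defining rules of \<open>S\<^sub>r\<close> assign
  the value \<open>s\<close> to \<open>R/I\<close>; as usual the value is regarded as a function of the ideal \<open>I\<close>.
  For a Dedekind domain unique factorisation of ideals makes this relation the
  graph of a function on the nonzero ideals of finite index. Powers of ideals are taken in the monoid
  \<^term>\<open>ideals_set R\<close>, and relatively prime means \<open>A + B = R\<close>.
\<close>

inductive schemmel_rel :: "('a, 'm) ring_scheme \<Rightarrow> nat \<Rightarrow> 'a set \<Rightarrow> nat \<Rightarrow> bool"
  for R (structure) and r :: nat where
  unit_ideal: "schemmel_rel R r (carrier R) 1"
| prime_power:
    "\<lbrakk> primeideal P R; P \<noteq> {\<zero>}; finite (carrier (R Quot P)); \<alpha> > 0;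
       q = card (carrier (R Quot P)) \<rbrakk> \<Longrightarrow>
     schemmel_rel R r (P [^]\<^bsub>ideals_set R\<^esub> (\<alpha> :: nat))
       (if r \<le> q then q ^ (\<alpha> - 1) * (q - r) else 0)"
| coprime_product:
    "\<lbrakk> ideal A R; A \<noteq> {\<zero>}; finite (carrier (R Quot A));
       ideal B R; B \<noteq> {\<zero>}; finite (carrier (R Quot B));
       A <+> B = carrier R; schemmel_rel R r A s; schemmel_rel R r B t \<rbrakk> \<Longrightarrow>
     schemmel_rel R r (A \<cdot> B) (s * t)"

definition schemmel :: "('a, 'm) ring_scheme \<Rightarrow> nat \<Rightarrow> 'a set \<Rightarrow> nat" where
  "schemmel R r I = (THE s. schemmel_rel R r I s)"

end

theory Submission
  imports Defs "HOL-Algebra.Ring_Divisibility"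
begin

text \<open>
  Whether \<open>z\<close> is a unit modulo \<open>I\<close> depends only on \<open>z\<close> modulo the primes containing \<open>I\<close>. Hence an
  \<open>r\<close>-clique of \<open>G\<^bsub>R/I\<^esub>\<close> can be extended to an \<open>(r+1)\<close>-clique in exactly \<open>\<S>\<^sub>r(R/I)\<close> ways: modulo \<open>P\<^sup>\<alpha>\<close> the new
  vertex has to avoid \<open>r\<close> distinct classes modulo \<open>P\<close>, each of which consists of \<open>|R/P|\<^sup>\<alpha>\<^sup>-\<^sup>1\<close>
  classes modulo \<open>P\<^sup>\<alpha>\<close>, and the Chinese remainder theorem treats coprime products. Double counting
  gives \<open>(r+1) c\<^sub>r\<^sub>+\<^sub>1 = c\<^sub>r \<S>\<^sub>r(R/I)\<close> for the numbers \<open>c\<^sub>r\<close> of \<open>r\<close>-cliques. If there is no \<open>r\<close>-clique, both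
  sides are zero whatever \<open>\<S>\<^sub>r(R/I)\<close> is, so the value of \<open>\<S>\<^sub>r\<close> need only be determined where an
  \<open>r\<close>-clique exists, and the uniqueness of the factorisation of \<open>I\<close> is not required.

  The arithmetic of \<open>R\<close> enters through the invertibility of a nonzero prime \<open>P\<close>, stated without
  fractional ideals. It gives the factorisation of \<open>I\<close> into powers of primes and shows that
  \<open>P\<^sup>n/P\<^sup>n\<^sup>+\<^sup>1\<close> is cyclic, hence of the same size as \<open>R/P\<close>.
\<close>

section \<open>Invertibility of nonzero primes\<close>

text \<open>A nonempty chain of ideals in a Noetherian ring contains its own union, so Zorn's lemma
  applies to every nonempty family of ideals, whatever its closure properties.\<close>

lemma (in noetherian_ring) exists_maximal_ideal_in:
  assumes "F \<noteq> {}" and "\<And>I. I \<in> F \<Longrightarrow> ideal I R"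
  shows "\<exists>M\<in>F. \<forall>J\<in>F. M \<subseteq> J \<longrightarrow> J = M"
proof (rule subset_Zorn)
  fix C assume C: "subset.chain F C"
  show "\<exists>U\<in>F. \<forall>Y\<in>C. Y \<subseteq> U"
  proof (cases "C = {}")
    case True
    then show ?thesis using assms(1) by blast
  next
    case False
    have "subset.chain {I. ideal I R} C"
      using C assms(2) unfolding pred_on.chain_def by blast
    then have "\<Union>C \<in> C" using ideal_chain_is_trivial False by blast
    moreover have "C \<subseteq> F" using C unfolding pred_on.chain_def by blast
    ultimately show ?thesis by (intro bexI[of _ "\<Union>C"]) auto
  qed
qed

text \<open>A maximal counterexample would violate \<open>step\<close>. This serves as induction
  over the factors of an ideal: splitting off a prime leaves a larger ideal.\<close>

lemma (in noetherian_ring) noetherian_ideal_induct [consumes 1, case_names step]: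
  assumes "ideal I R"
    and step: "\<And>I. \<lbrakk> ideal I R; \<And>J. \<lbrakk> ideal J R; I \<subset> J \<rbrakk> \<Longrightarrow> Q J \<rbrakk> \<Longrightarrow> Q I"
  shows "Q I"
proof (rule ccontr)
  assume "\<not> Q I"
  with assms(1) have "{J. ideal J R \<and> \<not> Q J} \<noteq> {}" by blast
  from exists_maximal_ideal_in[OF this]
  obtain M where M: "ideal M R" "\<not> Q M" "\<And>J. \<lbrakk> ideal J R; \<not> Q J; M \<subseteq> J \<rbrakk> \<Longrightarrow> J = M"
    by blast
  show False using step[OF M(1)] M(2,3) by blast
qed

lemma (in noetherian_ring) exists_maximalideal_containing:
  assumes "ideal I R" and "I \<noteq> carrier R"
  obtains P where "maximalideal P R" and "I \<subseteq> P"
proof -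
  let ?F = "{J. ideal J R \<and> J \<noteq> carrier R \<and> I \<subseteq> J}"
  have "?F \<noteq> {}" using assms by blast
  from exists_maximal_ideal_in[OF this]
  obtain M where M: "ideal M R" "M \<noteq> carrier R" "I \<subseteq> M" "\<forall>J\<in>?F. M \<subseteq> J \<longrightarrow> J = M"
    by blast
  have "maximalideal M R"
  proof (rule maximalidealI)
    fix J assume "ideal J R" "M \<subseteq> J" "J \<subseteq> carrier R"
    then show "J = M \<or> J = carrier R" using M(3,4) by blast
  qed (use M in auto)
  then show thesis using that M(3) by blast
qed

section \<open>Elementary ideal arithmetic\<close>

lemma (in cring) cring_idealI:
  assumes "I \<subseteq> carrier R" "\<zero> \<in> I"
    and add: "\<And>x y. \<lbrakk> x \<in> I; y \<in> I \<rbrakk> \<Longrightarrow> x \<oplus> y \<in> I"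
    and mult: "\<And>r x. \<lbrakk> r \<in> carrier R; x \<in> I \<rbrakk> \<Longrightarrow> r \<otimes> x \<in> I"
  shows "ideal I R"
proof (rule idealI)
  show "subgroup I (add_monoid R)"
  proof (rule add.subgroupI)
    fix x assume x: "x \<in> I"
    then have "(\<ominus> \<one>) \<otimes> x \<in> I" using mult by simp
    then show "\<ominus> x \<in> I" using x assms(1) by (simp add: l_minus subset_eq)
  qed (use assms in auto)
  fix a x assume "a \<in> I" "x \<in> carrier R"
  then show "x \<otimes> a \<in> I" and "a \<otimes> x \<in> I"
    using mult[of x a] assms(1) m_comm[of a x] by auto
qed (rule ring_axioms)

lemma (in ring) set_addI: "\<lbrakk> x \<in> A; y \<in> B \<rbrakk> \<Longrightarrow> x \<oplus> y \<in> A <+> B"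
  unfolding set_add_def' by blast

lemma (in ring) set_addE:
  assumes "z \<in> A <+>\<^bsub>R\<^esub> B"
  obtains x y where "x \<in> A" "y \<in> B" "z = x \<oplus> y"
  using assms unfolding set_add_def' by blast

lemma (in ring) subset_set_add1:
  assumes "ideal I R" "ideal J R" shows "I \<subseteq> I <+>\<^bsub>R\<^esub> J"
proof
  fix x assume x: "x \<in> I"
  then have "x \<oplus> \<zero> \<in> I <+> J"
    using assms(2) by (intro set_addI) (simp_all add: additive_subgroup.zero_closed ideal.axioms(1))
  then show "x \<in> I <+> J" using x ideal.Icarr[OF assms(1)] by simp
qed

lemma (in ring) subset_set_add2:
  assumes "ideal I R" "ideal J R" shows "J \<subseteq> I <+>\<^bsub>R\<^esub> J"
  using subset_set_add1[OF assms(2,1)] set_add_comm ideal.axioms(1)[OF assms(1)]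
    ideal.axioms(1)[OF assms(2)] additive_subgroup.a_subset by metis

lemma (in ideal) minus_mem:
  "\<lbrakk> x \<in> I; y \<in> I \<rbrakk> \<Longrightarrow> x \<ominus> y \<in> I"
  by (simp add: a_minus_def)

text \<open>By maximality the sum of \<open>I\<close> and the principal ideal of \<open>z\<close> is
  the whole ring; writing \<open>\<one>\<close> as an element of this sum exhibits the
  inverse.\<close>

lemma (in maximalideal) exists_inverse_modulo:
  assumes "cring R" and z: "z \<in> carrier R" "z \<notin> I"
  shows "\<exists>u\<in>carrier R. u \<otimes> z \<ominus> \<one> \<in> I"
proof -
  interpret cring R by fact
  let ?J = "PIdl z <+> I :: 'a set"
  have J: "ideal ?J R" by (intro add_ideals cgenideal_ideal z is_ideal)
  have sub: "I \<subseteq> ?J"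
    by (rule subset_set_add2[OF cgenideal_ideal[OF z(1)] is_ideal])
  have "z \<in> ?J"
    using subset_set_add1[OF cgenideal_ideal[OF z(1)] is_ideal] cgenideal_self[OF z(1)] by blast
  then have "?J \<noteq> I" using z by auto
  then have "?J = carrier R"
    using I_maximal[OF J sub] ideal.Icarr[OF J] by blast
  then have "\<one> \<in> ?J" by simp
  then obtain u i where ui: "u \<in> carrier R" "i \<in> I" "\<one> = u \<otimes> z \<oplus> i"
    unfolding set_add_def' cgenideal_def by blast
  have "u \<otimes> z \<ominus> \<one> = u \<otimes> z \<ominus> (u \<otimes> z \<oplus> i)" using ui(3) by simp
  also have "\<dots> = \<ominus> i" using ui(1) Icarr[OF ui(2)] z(1) by algebra
  finally have "u \<otimes> z \<ominus> \<one> \<in> I" using ui(2) by simp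
  then show ?thesis using ui(1) by blast
qed

section \<open>Integral closedness and the inverse of a nonzero prime\<close>

context dedekind_domain
begin

text \<open>
  In the field of fractions, \<open>x = b/a\<close> maps \<open>I\<close> to itself. For \<open>p \<in> I\<close> nonzero, the ideals
  \<open>p(R + Rx + \<dots> + Rx\<^sup>n)\<close> lie in \<open>R\<close> and form an ascending chain; where it becomes stationary one
  reads off an integral equation for \<open>x\<close>.
\<close>

lemma divides_if_stabilizes_ideal:
  assumes ab: "a \<in> carrier R" "b \<in> carrier R" "a \<noteq> \<zero>"
    and I: "ideal I R" "I \<noteq> {\<zero>}"
    and stab: "\<And>c. c \<in> I \<Longrightarrow> \<exists>c'\<in>I. b \<otimes> c = a \<otimes> c'"
  shows "\<exists>c\<in>carrier R. b = a \<otimes> c"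
proof -
  interpret I: ideal I R by (rule I(1))
  obtain f where f: "\<And>c. c \<in> I \<Longrightarrow> f c \<in> I \<and> b \<otimes> c = a \<otimes> f c" using stab by metis
  obtain p0 where p0: "p0 \<in> I" "p0 \<noteq> \<zero>" using I(2) I.zero_closed by blast
  \<comment> \<open>In the field of fractions \<open>p n\<close> is \<open>p0\<close> times the
    \<open>n\<close>-th power of x = b/a. Iterating \<open>f\<close> expresses this inside
    \<open>I\<close>, without denominators.\<close>
  define p where "p n = (f ^^ n) p0" for n
  have pI: "p n \<in> I" for n unfolding p_def using f p0 by (induction n) auto
  have pc: "p n \<in> carrier R" for n using pI I.Icarr by blast
  have pS: "b \<otimes> p n = a \<otimes> p (Suc n)" for n using f[OF pI] by (simp add: p_def)
  \<comment> \<open>\<open>J n\<close> is generated by the \<open>n\<close> elements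
    \<open>p 0\<close>, ..., \<open>p (n - 1)\<close>. Hence \<open>p n \<in> J n\<close> is, up to
    the factor \<open>p0\<close>, an integral equation of degree \<open>n\<close>.\<close>
  define J where "J = rec_nat {\<zero>} (\<lambda>n (Y :: 'a set). PIdl (p n) <+> Y)"
  have J0: "J 0 = {\<zero>}" and JS: "J (Suc n) = PIdl (p n) <+> J n" for n
    by (simp_all add: J_def)
  have Jid: "ideal (J n) R" for n
    by (induction n) (auto simp: J0 JS zeroideal intro!: add_ideals cgenideal_ideal pc)
  have "\<exists>M\<in>range J. \<forall>Y\<in>range J. M \<subseteq> Y \<longrightarrow> Y = M"
    by (rule exists_maximal_ideal_in) (use Jid in auto)
  then obtain M where M: "M \<in> range J" "\<forall>Y\<in>range J. M \<subseteq> Y \<longrightarrow> Y = M"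
    by (elim bexE)
  from M(1) obtain n where "M = J n" by (elim rangeE)
  with M(2) have n: "J n \<subseteq> J k \<Longrightarrow> J k = J n" for k by simp
  have "J n \<subseteq> J (Suc n)"
    unfolding JS by (rule subset_set_add2[OF cgenideal_ideal[OF pc] Jid])
  then have "J (Suc n) = J n" by (rule n)
  moreover have "p n \<in> J (Suc n)" unfolding JS
    using subset_set_add1[OF cgenideal_ideal[OF pc] Jid] cgenideal_self[OF pc] by blast
  ultimately have pJ: "p n \<in> J n" by simp
  obtain K :: "('a \<times> 'a) set ring" and h where K: "fraction_field_via R K h"
    and ic: "\<And>x. \<lbrakk> x \<in> carrier K; integral_over K (h ` carrier R) x \<rbrakk> \<Longrightarrow> x \<in> h ` carrier R"
    using integrally_closed unfolding integrally_closed_def by blast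
  interpret K: field K using K unfolding fraction_field_via_def by blast
  have hom: "h \<in> ring_hom R K" and inj: "inj_on h (carrier R)"
    using K unfolding fraction_field_via_def by auto
  interpret h: ring_hom_ring R K h
    by (rule ring_hom_ringI2[OF ring_axioms K.ring_axioms hom])
  have nz: "h c \<noteq> \<zero>\<^bsub>K\<^esub>" if "c \<in> carrier R" "c \<noteq> \<zero>" for c
    using inj_onD[OF inj, of c \<zero>] that h.hom_zero by auto
  have ha: "h a \<in> Units K" using nz ab K.field_Units by auto
  define x where "x = h b \<otimes>\<^bsub>K\<^esub> inv\<^bsub>K\<^esub> h a"
  have xc: "x \<in> carrier K" unfolding x_def using ab ha by simp
  have xa: "x \<otimes>\<^bsub>K\<^esub> h a = h b"
    unfolding x_def using ab ha by (simp add: K.m_assoc)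
  have hp: "h (p n) = h p0 \<otimes>\<^bsub>K\<^esub> x [^]\<^bsub>K\<^esub> n" for n
  proof (induction n)
    case 0
    then show ?case using p0 I.Icarr by (simp add: p_def)
  next
    case (Suc n)
    have "h a \<otimes>\<^bsub>K\<^esub> h (p (Suc n)) = h (a \<otimes> p (Suc n))" using ab pc by simp
    also have "\<dots> = h (b \<otimes> p n)" by (simp only: pS)
    also have "\<dots> = (x \<otimes>\<^bsub>K\<^esub> h a) \<otimes>\<^bsub>K\<^esub> h (p n)" using ab pc by (simp add: xa)
    also have "\<dots> = h a \<otimes>\<^bsub>K\<^esub> (h (p n) \<otimes>\<^bsub>K\<^esub> x)"
      using ab pc xc by (simp add: K.m_ac)
    finally have "h (p (Suc n)) = h (p n) \<otimes>\<^bsub>K\<^esub> x"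
      using ha pc xc ab nz K.m_lcancel by simp
    also have "\<dots> = h p0 \<otimes>\<^bsub>K\<^esub> x [^]\<^bsub>K\<^esub> Suc n"
      using Suc xc p0 I.Icarr by (simp add: K.m_assoc)
    finally show ?case .
  qed
  \<comment> \<open>Coefficient lists start with the highest degree, so length \<open>n\<close>
    means degree below \<open>n\<close>, and putting \<open>h r\<close> in front of \<open>l\<close>
    adds the term of degree \<open>n\<close>.\<close>
  have "\<exists>l. length l = n \<and> set l \<subseteq> h ` carrier R \<and> h j = h p0 \<otimes>\<^bsub>K\<^esub> K.eval l x" if "j \<in> J n" for n j
    using that
  proof (induction n arbitrary: j)
    case 0
    then show ?case using p0 I.Icarr by (auto simp: J0)
  next
    case (Suc n)
    then obtain r i where ri: "r \<in> carrier R" "i \<in> J n" "j = r \<otimes> p n \<oplus> i"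
      unfolding JS set_add_def' cgenideal_def by blast
    obtain l where l: "length l = n" "set l \<subseteq> h ` carrier R" "h i = h p0 \<otimes>\<^bsub>K\<^esub> K.eval l x"
      using Suc.IH[OF ri(2)] by blast
    have lc: "K.eval l x \<in> carrier K"
      by (rule K.eval_in_carrier) (use l xc in auto)
    have "h j = h r \<otimes>\<^bsub>K\<^esub> h (p n) \<oplus>\<^bsub>K\<^esub> h i"
      using ri ideal.Icarr[OF Jid ri(2)] pc by simp
    also have "\<dots> = h p0 \<otimes>\<^bsub>K\<^esub> (h r \<otimes>\<^bsub>K\<^esub> x [^]\<^bsub>K\<^esub> n \<oplus>\<^bsub>K\<^esub> K.eval l x)"
      using l lc ri xc p0 I.Icarr by (simp add: hp K.r_distr K.m_lcomm)
    also have "\<dots> = h p0 \<otimes>\<^bsub>K\<^esub> K.eval (h r # l) x" using l by simp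
    finally show ?case using l ri(1) by (intro exI[of _ "h r # l"]) auto
  qed
  from this[OF pJ] obtain l where l: "length l = n" "set l \<subseteq> h ` carrier R"
      "h (p n) = h p0 \<otimes>\<^bsub>K\<^esub> K.eval l x" by blast
  have lc: "set l \<subseteq> carrier K" using l by auto
  have ec: "K.eval l x \<in> carrier K" by (rule K.eval_in_carrier[OF lc xc])
  have hp0: "h p0 \<in> carrier K" "h p0 \<noteq> \<zero>\<^bsub>K\<^esub>" using nz p0 I.Icarr by auto
  have "h p0 \<otimes>\<^bsub>K\<^esub> x [^]\<^bsub>K\<^esub> n = h p0 \<otimes>\<^bsub>K\<^esub> K.eval l x" using l hp by simp
  then have xn: "x [^]\<^bsub>K\<^esub> n = K.eval l x"
    using K.m_lcancel[OF hp0(2) hp0(1) _ ec] xc by simp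
  have neg: "K.eval (map (\<lambda>c. \<ominus>\<^bsub>K\<^esub> c) q) x = \<ominus>\<^bsub>K\<^esub> K.eval q x" if "set q \<subseteq> carrier K" for q
    using that
  proof (induction q)
    case (Cons c q)
    then have "K.eval q x \<in> carrier K" by (intro K.eval_in_carrier xc) auto
    then show ?case using Cons xc by (simp add: K.l_minus K.minus_add)
  qed simp
  \<comment> \<open>The monic polynomial X^n minus the one given by \<open>l\<close>; by
    \<open>xn\<close> it vanishes at \<open>x\<close>.\<close>
  let ?q = "\<one>\<^bsub>K\<^esub> # map (\<lambda>c. \<ominus>\<^bsub>K\<^esub> c) l"
  have "set ?q \<subseteq> h ` carrier R"
  proof -
    have "\<one>\<^bsub>K\<^esub> \<in> h ` carrier R" using h.hom_one by (metis image_eqI one_closed)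
    moreover have "\<ominus>\<^bsub>K\<^esub> c \<in> h ` carrier R" if "c \<in> set l" for c
    proof -
      from l(2) that have "c \<in> h ` carrier R" by (rule subsetD)
      then obtain d where "d \<in> carrier R" "c = h d" by (elim imageE)
      then have "\<ominus>\<^bsub>K\<^esub> c = h (\<ominus> d)" by simp
      then show ?thesis using \<open>d \<in> carrier R\<close> by blast
    qed
    ultimately show ?thesis by auto
  qed
  moreover have "K.eval ?q x = \<zero>\<^bsub>K\<^esub>"
    using neg[OF lc] xn l ec by (simp add: K.r_neg)
  ultimately have "integral_over K (h ` carrier R) x"
    unfolding integral_over_def polynomial_def
    by (intro exI[of _ ?q] conjI disjI2) simp_all
  from ic[OF xc this] obtain c where c: "c \<in> carrier R" "x = h c" by blast
  have "h b = h (a \<otimes> c)" using xa c ab K.m_comm[of "h c" "h a"] by simp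
  then have "b = a \<otimes> c" using inj_onD[OF inj] ab c by simp
  then show ?thesis using c by blast
qed

text \<open>
  The fraction \<open>b/a\<close> lies in the inverse \<open>P\<^sup>-\<^sup>1\<close>, and \<open>a = ap + bp'\<close> expresses \<open>P P\<^sup>-\<^sup>1 = R\<close>.
\<close>

lemma prime_ideal_invertible:
  assumes P: "primeideal P R" "P \<noteq> {\<zero>}"
  obtains a b p p' where "a \<in> carrier R" "a \<noteq> \<zero>" "b \<in> carrier R" "p \<in> P" "p' \<in> P"
    "a = a \<otimes> p \<oplus> b \<otimes> p'" "\<not> (\<exists>c\<in>carrier R. b = a \<otimes> c)"
    "\<And>c. c \<in> P \<Longrightarrow> \<exists>c'\<in>carrier R. b \<otimes> c = a \<otimes> c'"
proof -
  interpret P: primeideal P R by (rule P(1))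
  have oneP: "\<one> \<notin> P" using P.one_imp_carrier P.I_notcarr by blast
  obtain a where a: "a \<in> P" "a \<noteq> \<zero>" using P(2) P.zero_closed by blast
  have ac: "a \<in> carrier R" using a P.Icarr by blast
  \<comment> \<open>A colon ideal \<open>(a : b)\<close> maximal among those contained in \<open>P\<close> is prime, hence equal to \<open>P\<close>.\<close>
  let ?D = "PIdl a"
  interpret D: ideal ?D R by (rule cgenideal_ideal[OF ac])
  define M where "M b = {x \<in> carrier R. b \<otimes> x \<in> ?D}" for b
  have Mid: "ideal (M b) R" if "b \<in> carrier R" for b
    unfolding M_def by (rule D.helper_max_prime[OF is_cring that])
  let ?F = "{M b | b. b \<in> carrier R \<and> M b \<subseteq> P}"
  have DP: "?D \<subseteq> P" by (rule cgenideal_minimal[OF P.is_ideal a(1)])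
  \<comment> \<open>\<open>M \<one>\<close> is the principal ideal \<open>?D\<close> itself, so the
    family is nonempty.\<close>
  have "M \<one> \<subseteq> P" unfolding M_def using DP by auto
  then have "?F \<noteq> {}" by blast
  then have "\<exists>M0\<in>?F. \<forall>Y\<in>?F. M0 \<subseteq> Y \<longrightarrow> Y = M0"
    by (rule exists_maximal_ideal_in) (use Mid in auto)
  then obtain M0 where M0: "M0 \<in> ?F" "\<forall>Y\<in>?F. M0 \<subseteq> Y \<longrightarrow> Y = M0"
    by (elim bexE)
  from M0(1) obtain b where b: "b \<in> carrier R" "M b \<subseteq> P" "M0 = M b" by blast
  have max: "M d = M b" if "d \<in> carrier R" "M d \<subseteq> P" "M b \<subseteq> M d" for d
  proof -
    from that have "M d \<in> ?F" by blast
    with M0(2) that(3) show ?thesis unfolding b(3) by simp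
  qed
  have mono: "M b \<subseteq> M (b \<otimes> s)" if s: "s \<in> carrier R" for s
  proof
    fix x assume "x \<in> M b"
    then have x: "x \<in> carrier R" "b \<otimes> x \<in> ?D" by (auto simp: M_def)
    have "(b \<otimes> x) \<otimes> s \<in> ?D" using D.I_r_closed x s by blast
    moreover have "(b \<otimes> x) \<otimes> s = (b \<otimes> s) \<otimes> x" using b x s by (simp add: m_ac)
    ultimately show "x \<in> M (b \<otimes> s)" using x by (simp add: M_def)
  qed
  \<comment> \<open>Suppose \<open>s\<close> outside \<open>P\<close> satisfies bxs \<in>
    \<open>?D\<close>. Primality of \<open>P\<close> keeps \<open>M (b \<otimes> s)\<close> inside
    \<open>P\<close>, so maximality gives \<open>M (b \<otimes> s) = M b\<close>; but
    \<open>x\<close> lies only in the former.\<close>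
  have colon: "M (b \<otimes> x) \<subseteq> P" if x: "x \<in> carrier R" "x \<notin> M b" for x
  proof (rule ccontr)
    assume "\<not> M (b \<otimes> x) \<subseteq> P"
    then obtain s where s: "s \<in> carrier R" "b \<otimes> x \<otimes> s \<in> ?D" "s \<notin> P" by (auto simp: M_def)
    have "M (b \<otimes> s) \<subseteq> P"
    proof
      fix u assume "u \<in> M (b \<otimes> s)"
      then have u: "u \<in> carrier R" "b \<otimes> s \<otimes> u \<in> ?D" by (auto simp: M_def)
      then have "s \<otimes> u \<in> M b" using b s by (simp add: M_def m_assoc)
      then have "s \<otimes> u \<in> P" using b(2) by blast
      then show "u \<in> P" using P.I_prime[OF s(1) u(1)] s(3) by blast
    qed
    then have "M (b \<otimes> s) = M b" using max mono b s by simp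
    moreover have "b \<otimes> s \<otimes> x \<in> ?D" using s x b by (simp add: m_ac)
    then have "x \<in> M (b \<otimes> s)" using x by (simp add: M_def)
    ultimately show False using x by blast
  qed
  have aM: "a \<in> M b" using ac cgenideal_self[OF ac] D.I_l_closed b by (simp add: M_def)
  have "primeideal (M b) R"
  proof (rule primeidealI[OF Mid[OF b(1)] is_cring])
    show "carrier R \<noteq> M b" using b(2) oneP by auto
    fix x y assume xy: "x \<in> carrier R" "y \<in> carrier R" "x \<otimes> y \<in> M b"
    show "x \<in> M b \<or> y \<in> M b"
    proof (rule disjCI)
      assume "y \<notin> M b"
      then have "M (b \<otimes> y) = M b" using max colon mono b xy by simp
      moreover have "x \<in> M (b \<otimes> y)" using xy b by (simp add: M_def m_ac)
      ultimately show "x \<in> M b" by blast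
    qed
  qed
  \<comment> \<open>Dimension one enters here: as a nonzero prime, \<open>M b\<close> is maximal,
    and a maximal ideal inside the proper ideal \<open>P\<close> equals \<open>P\<close>.\<close>
  moreover have "M b \<noteq> {\<zero>}" using aM a(2) by blast
  ultimately interpret M: maximalideal "M b" R by (rule nonzero_prime_maximal)
  have "P \<subseteq> carrier R" using P.Icarr by blast
  then have MP: "M b = P" using M.I_maximal[OF P.is_ideal b(2)] P.I_notcarr by blast
  interpret P: maximalideal P R using nonzero_prime_maximal P by blast
  have bP: "\<exists>c'\<in>carrier R. b \<otimes> c = a \<otimes> c'" if "c \<in> P" for c
  proof -
    have "b \<otimes> c \<in> ?D" using that MP M_def by blast
    then obtain c' where c': "c' \<in> carrier R" "b \<otimes> c = c' \<otimes> a" unfolding cgenideal_def by blast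
    then show ?thesis using m_comm[OF c'(1) ac] by auto
  qed
  have nb: "\<not> (\<exists>c\<in>carrier R. b = a \<otimes> c)"
  proof
    assume "\<exists>c\<in>carrier R. b = a \<otimes> c"
    then obtain c where c: "c \<in> carrier R" "b = a \<otimes> c" by blast
    then have "b \<otimes> \<one> = c \<otimes> a" using ac m_comm[OF ac c(1)] by simp
    then have "b \<otimes> \<one> \<in> ?D" unfolding cgenideal_def using c(1) by blast
    then have "\<one> \<in> M b" unfolding M_def using one_closed by blast
    then show False using b(2) oneP by blast
  qed
  \<comment> \<open>\<open>N\<close> is \<open>P + (b/a)P\<close>; it cannot be \<open>P\<close> because \<open>b/a\<close> is not integral.\<close>
  define N where "N = {c \<in> carrier R. \<exists>p\<in>P. \<exists>p'\<in>P. a \<otimes> c = a \<otimes> p \<oplus> b \<otimes> p'}"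
  have N: "ideal N R"
  proof (rule cring_idealI)
    have "a \<otimes> \<zero> = a \<otimes> \<zero> \<oplus> b \<otimes> \<zero>" using ac b by simp
    then show "\<zero> \<in> N" unfolding N_def using P.zero_closed by blast
  next
    fix x y assume "x \<in> N" "y \<in> N"
    then obtain p p' q q' where *: "x \<in> carrier R" "y \<in> carrier R" "p \<in> P" "p' \<in> P" "q \<in> P" "q' \<in> P"
      "a \<otimes> x = a \<otimes> p \<oplus> b \<otimes> p'" "a \<otimes> y = a \<otimes> q \<oplus> b \<otimes> q'" unfolding N_def by blast
    have "a \<otimes> (x \<oplus> y) = (a \<otimes> p \<oplus> b \<otimes> p') \<oplus> (a \<otimes> q \<oplus> b \<otimes> q')"
      using * ac by (simp add: r_distr)
    also have "\<dots> = a \<otimes> (p \<oplus> q) \<oplus> b \<otimes> (p' \<oplus> q')"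
      using *(3-6)[THEN P.Icarr] ac b(1) by algebra
    finally show "x \<oplus> y \<in> N" unfolding N_def using * by blast
  next
    fix r x assume r: "r \<in> carrier R" "x \<in> N"
    then obtain p p' where *: "x \<in> carrier R" "p \<in> P" "p' \<in> P" "a \<otimes> x = a \<otimes> p \<oplus> b \<otimes> p'"
      unfolding N_def by blast
    have "a \<otimes> (r \<otimes> x) = r \<otimes> (a \<otimes> p \<oplus> b \<otimes> p')"
      using * ac r by (simp add: m_lcomm flip: *(4))
    also have "\<dots> = a \<otimes> (r \<otimes> p) \<oplus> b \<otimes> (r \<otimes> p')"
      using *(2,3)[THEN P.Icarr] ac b(1) r(1) by algebra
    finally show "r \<otimes> x \<in> N" unfolding N_def using * r P.I_l_closed by blast
  qed (auto simp: N_def)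
  have "P \<subseteq> N"
  proof
    fix c assume c: "c \<in> P"
    have "a \<otimes> c = a \<otimes> c \<oplus> b \<otimes> \<zero>" using ac b c P.Icarr by simp
    then show "c \<in> N" unfolding N_def using c P.zero_closed P.Icarr by blast
  qed
  moreover have "N \<noteq> P"
  proof
    assume NP: "N = P"
    have "\<exists>c'\<in>P. b \<otimes> c = a \<otimes> c'" if c: "c \<in> P" for c
    proof -
      obtain c' where c': "c' \<in> carrier R" "b \<otimes> c = a \<otimes> c'" using bP[OF c] by blast
      have "a \<otimes> c' = a \<otimes> \<zero> \<oplus> b \<otimes> c" using c' ac b c P.Icarr by simp
      then have "c' \<in> N" unfolding N_def using c' c P.zero_closed by blast
      then show ?thesis using NP c' by blast
    qed
    then show False
      using divides_if_stabilizes_ideal[OF ac b(1) a(2) P.is_ideal P(2)] nb by blast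
  qed
  ultimately have "N = carrier R" using P.I_maximal[OF N] by (auto simp: N_def)
  then have "\<one> \<in> N" by simp
  then obtain p p' where "p \<in> P" "p' \<in> P" "a = a \<otimes> p \<oplus> b \<otimes> p'" unfolding N_def using ac by auto
  then show thesis using that[OF ac a(2) b(1)] nb bP by blast
qed

section \<open>Dividing by a nonzero prime\<close>

lemma ideal_colon:
  assumes "ideal I R" "ideal P R"
  shows "ideal {c \<in> carrier R. \<forall>d\<in>P. c \<otimes> d \<in> I} R"
proof -
  interpret I: ideal I R by fact
  interpret P: ideal P R by fact
  show ?thesis
  proof (rule cring_idealI)
    show "\<zero> \<in> {c \<in> carrier R. \<forall>d\<in>P. c \<otimes> d \<in> I}" using P.Icarr by simp
  qed (use P.Icarr I.I_l_closed in \<open>auto simp: l_distr m_assoc\<close>)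
qed

text \<open>To contain is to divide. The cofactor is the colon ideal (I : P), which plays the part
  of I P^-1. For \<open>c \<in> I\<close> put c' = (b/a)c; the relation a = ap + bp' becomes c = pc
  + p'c', and both \<open>c\<close> and \<open>c'\<close> lie in the colon ideal.\<close>

lemma prime_dvd_ideal:
  assumes P: "primeideal P R" "P \<noteq> {\<zero>}" and I: "ideal I R" "I \<subseteq> P"
  shows "I = P \<cdot> {c \<in> carrier R. \<forall>d\<in>P. c \<otimes> d \<in> I}"
proof -
  interpret P: primeideal P R by (rule P(1))
  interpret I: ideal I R by (rule I(1))
  define C where "C = {c \<in> carrier R. \<forall>d\<in>P. c \<otimes> d \<in> I}"
  obtain a b p p' where ab: "a \<in> carrier R" "a \<noteq> \<zero>" "b \<in> carrier R" "p \<in> P" "p' \<in> P"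
    "a = a \<otimes> p \<oplus> b \<otimes> p'" and bP: "\<And>c. c \<in> P \<Longrightarrow> \<exists>c'\<in>carrier R. b \<otimes> c = a \<otimes> c'"
    using prime_ideal_invertible[OF P] by metis
  have "x \<in> I" if "x \<in> P \<cdot> C" for x
    using that
  proof induction
    case (prod i j)
    then show ?case unfolding C_def using P.Icarr by (auto simp: m_comm[of i j])
  qed simp
  moreover have "c \<in> P \<cdot> C" if c: "c \<in> I" for c
  proof -
    have cc: "c \<in> carrier R" "p \<in> carrier R" "p' \<in> carrier R" using c I.Icarr ab P.Icarr by auto
    obtain c' where c': "c' \<in> carrier R" "b \<otimes> c = a \<otimes> c'" using bP c I(2) by blast
    have "c' \<otimes> d \<in> I" if d: "d \<in> P" for d
    proof -
      have dc: "d \<in> carrier R" using d P.Icarr by blast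
      obtain d' where d': "d' \<in> carrier R" "b \<otimes> d = a \<otimes> d'" using bP d by blast
      have "a \<otimes> (c' \<otimes> d) = (b \<otimes> c) \<otimes> d" using c' dc ab by (simp add: m_assoc)
      also have "\<dots> = (b \<otimes> d) \<otimes> c" using dc cc ab by (simp add: m_ac)
      also have "\<dots> = a \<otimes> (d' \<otimes> c)" using d' cc ab by (simp add: m_assoc)
      finally have "c' \<otimes> d = d' \<otimes> c" using m_lcancel[OF ab(2,1)] c' d' dc cc by simp
      then show ?thesis using I.I_l_closed[OF c d'(1)] by simp
    qed
    then have 1: "c' \<in> C" using c' C_def by blast
    have 2: "c \<in> C" unfolding C_def using cc I.I_r_closed[OF c] P.Icarr by blast
    have "a \<otimes> c = (a \<otimes> p \<oplus> b \<otimes> p') \<otimes> c" using ab by simp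
    also have "\<dots> = a \<otimes> (p \<otimes> c) \<oplus> (b \<otimes> c) \<otimes> p'" using cc ab(1,3) by algebra
    also have "\<dots> = a \<otimes> (p \<otimes> c \<oplus> p' \<otimes> c')"
      unfolding c'(2) using cc c'(1) ab(1,3) by algebra
    finally have "c = p \<otimes> c \<oplus> p' \<otimes> c'" using m_lcancel[OF ab(2,1)] c' cc by simp
    then show ?thesis using ideal_prod.sum[OF ideal_prod.prod ideal_prod.prod] ab 1 2 by metis
  qed
  ultimately show ?thesis unfolding C_def by blast
qed

text \<open>The fraction b/a from the inverse of \<open>P\<close> maps PI into \<open>I\<close>. If
  PI = I, it would stabilise the nonzero ideal \<open>I\<close> and hence lie in \<open>R\<close>,
  which it does not. This takes the place of cancellation of ideals.\<close>

lemma prime_mult_ideal_neq: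
  assumes P: "primeideal P R" "P \<noteq> {\<zero>}" and I: "ideal I R" "I \<noteq> {\<zero>}"
  shows "P \<cdot> I \<noteq> I"
proof
  assume PI: "P \<cdot> I = I"
  interpret P: primeideal P R by (rule P(1))
  interpret I: ideal I R by (rule I(1))
  obtain a b where ab: "a \<in> carrier R" "a \<noteq> \<zero>" "b \<in> carrier R" "\<not> (\<exists>c\<in>carrier R. b = a \<otimes> c)"
     and bP: "\<And>c. c \<in> P \<Longrightarrow> \<exists>c'\<in>carrier R. b \<otimes> c = a \<otimes> c'"
    using prime_ideal_invertible[OF P] by metis
  have "\<exists>c'\<in>I. b \<otimes> c = a \<otimes> c'" if "c \<in> P \<cdot> I" for c
    using that
  proof induction
    case (prod i j)
    obtain i' where i': "i' \<in> carrier R" "b \<otimes> i = a \<otimes> i'" using bP prod by blast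
    have "b \<otimes> (i \<otimes> j) = a \<otimes> (i' \<otimes> j)"
      using ab i' prod P.Icarr I.Icarr by (simp flip: m_assoc)
    then show ?case using I.I_l_closed[OF prod(2) i'(1)] by blast
  next
    case (sum s1 s2)
    then obtain t1 t2 where t: "t1 \<in> I" "t2 \<in> I" "b \<otimes> s1 = a \<otimes> t1" "b \<otimes> s2 = a \<otimes> t2" by blast
    have "b \<otimes> (s1 \<oplus> s2) = a \<otimes> (t1 \<oplus> t2)"
      using t ab I.Icarr sum(1,2) unfolding PI by (simp add: r_distr)
    then show ?case using t by blast
  qed
  then show False
    using divides_if_stabilizes_ideal[OF ab(1,3,2) I] ab(4) unfolding PI by blast
qed

end

section \<open>Units modulo an ideal and counting cosets\<close>

text \<open>Invertibility of the class of \<open>z\<close> in R/I, phrased with elements of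
  \<open>R\<close> so that conditions for several ideals can be compared within one ring.
  \<open>rcos_Units_iff\<close> connects it with \<open>Units (R Quot I)\<close>.\<close>

definition unit_modulo :: "('a, 'm) ring_scheme \<Rightarrow> 'a set \<Rightarrow> 'a \<Rightarrow> bool" where
  "unit_modulo R I z \<longleftrightarrow> (\<exists>u\<in>carrier R. u \<otimes>\<^bsub>R\<^esub> z \<ominus>\<^bsub>R\<^esub> \<one>\<^bsub>R\<^esub> \<in> I)"

context cring
begin

lemma carrier_Quot: "carrier (R Quot I) = (\<lambda>y. I +> y) ` carrier R"
  unfolding FactRing_def A_RCOSETS_def' by auto

lemma ideal_mem_cong:
  assumes I: "ideal I R" and xy: "x \<in> carrier R" "y \<in> carrier R" "x \<ominus> y \<in> I"
  shows "x \<in> I \<longleftrightarrow> y \<in> I"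
proof -
  interpret I: ideal I R by (rule I)
  have "y = x \<ominus> (x \<ominus> y)" "x = (x \<ominus> y) \<oplus> y" using xy(1,2) by algebra+
  then show ?thesis using I.minus_mem I.a_closed xy(3) by metis
qed

lemma unit_modulo_cong:
  assumes I: "ideal I R" and xy: "x \<in> carrier R" "y \<in> carrier R" "x \<ominus> y \<in> I"
  shows "unit_modulo R I x \<longleftrightarrow> unit_modulo R I y"
proof -
  interpret I: ideal I R by (rule I)
  have "u \<otimes> x \<ominus> \<one> \<in> I \<longleftrightarrow> u \<otimes> y \<ominus> \<one> \<in> I" if u: "u \<in> carrier R" for u
  proof (rule ideal_mem_cong[OF I])
    have "(u \<otimes> x \<ominus> \<one>) \<ominus> (u \<otimes> y \<ominus> \<one>) = u \<otimes> (x \<ominus> y)" using u xy(1,2) by algebra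
    then show "(u \<otimes> x \<ominus> \<one>) \<ominus> (u \<otimes> y \<ominus> \<one>) \<in> I" using I.I_l_closed[OF xy(3) u] by simp
  qed (use u xy in auto)
  then show ?thesis unfolding unit_modulo_def by blast
qed

lemma unit_modulo_carrier: "z \<in> carrier R \<Longrightarrow> unit_modulo R (carrier R) z"
  unfolding unit_modulo_def by auto

text \<open>If \<open>u\<close> inverts \<open>z\<close> modulo \<open>A\<close> and
  \<open>v\<close> does so modulo \<open>B\<close>, then (uz - 1)(vz - 1) lies in AB, and expanding
  it shows that u + v - uvz inverts \<open>z\<close> modulo AB. The factors may coincide, so powers
  of an ideal are covered too.\<close>

lemma unit_modulo_prod:
  assumes A: "ideal A R" and B: "ideal B R" and z: "z \<in> carrier R"
  shows "unit_modulo R (A \<cdot> B) z \<longleftrightarrow> unit_modulo R A z \<and> unit_modulo R B z"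
proof
  assume "unit_modulo R (A \<cdot> B) z"
  then show "unit_modulo R A z \<and> unit_modulo R B z"
    unfolding unit_modulo_def using ideal_prod_inter[OF A B] by blast
next
  assume "unit_modulo R A z \<and> unit_modulo R B z"
  then obtain u v where u: "u \<in> carrier R" "u \<otimes> z \<ominus> \<one> \<in> A"
    and v: "v \<in> carrier R" "v \<otimes> z \<ominus> \<one> \<in> B" unfolding unit_modulo_def by blast
  have "(u \<otimes> z \<ominus> \<one>) \<otimes> (v \<otimes> z \<ominus> \<one>) \<in> A \<cdot> B" by (rule ideal_prod.prod[OF u(2) v(2)])
  then have "\<ominus> ((u \<otimes> z \<ominus> \<one>) \<otimes> (v \<otimes> z \<ominus> \<one>)) \<in> A \<cdot> B"
    by (rule additive_subgroup.a_inv_closed[OF ideal.axioms(1)[OF ideal_prod_is_ideal[OF A B]]])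
  moreover have "\<ominus> ((u \<otimes> z \<ominus> \<one>) \<otimes> (v \<otimes> z \<ominus> \<one>)) = (u \<oplus> v \<ominus> u \<otimes> v \<otimes> z) \<otimes> z \<ominus> \<one>"
    using u(1) v(1) z by algebra
  ultimately show "unit_modulo R (A \<cdot> B) z" unfolding unit_modulo_def using u(1) v(1) z by auto
qed

lemma unit_modulo_maximalideal:
  assumes P: "maximalideal P R" and z: "z \<in> carrier R"
  shows "unit_modulo R P z \<longleftrightarrow> z \<notin> P"
proof
  interpret P: maximalideal P R by (rule P)
  assume "unit_modulo R P z"
  then obtain u where u: "u \<in> carrier R" "u \<otimes> z \<ominus> \<one> \<in> P" unfolding unit_modulo_def by blast
  show "z \<notin> P"
  proof
    assume "z \<in> P"
    then have "u \<otimes> z \<in> P" using P.I_l_closed u by blast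
    then have "\<one> \<in> P" using ideal_mem_cong[OF P.is_ideal _ _ u(2)] u z by simp
    then show False using P.one_imp_carrier P.I_notcarr by blast
  qed
next
  assume "z \<notin> P"
  then show "unit_modulo R P z"
    unfolding unit_modulo_def using maximalideal.exists_inverse_modulo[OF P is_cring z] by blast
qed

section \<open>Powers of an ideal\<close>

lemma ideals_set_pow_0: "P [^]\<^bsub>ideals_set R\<^esub> (0 :: nat) = carrier R"
  by (simp add: nat_pow_def ideals_set_def)

lemma ideals_set_pow_Suc: "P [^]\<^bsub>ideals_set R\<^esub> Suc n = (P [^]\<^bsub>ideals_set R\<^esub> n) \<cdot> P"
  by (simp add: nat_pow_def ideals_set_def)

lemma ideal_ideals_set_pow:
  fixes n :: nat
  assumes "ideal P R" shows "ideal (P [^]\<^bsub>ideals_set R\<^esub> n) R"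
  by (induction n)
    (simp_all only: ideals_set_pow_0 ideals_set_pow_Suc oneideal ideal_prod_is_ideal assms)

lemma ideals_set_pow_1: "ideal P R \<Longrightarrow> P [^]\<^bsub>ideals_set R\<^esub> Suc 0 = P"
  using ideals_set_pow_Suc[of P 0] ideal_prod_one ideal_prod_commute oneideal
  unfolding ideals_set_pow_0 by metis

lemma unit_modulo_pow:
  assumes P: "ideal P R" and z: "z \<in> carrier R" and n: "n > 0"
  shows "unit_modulo R (P [^]\<^bsub>ideals_set R\<^esub> (n :: nat)) z \<longleftrightarrow> unit_modulo R P z"
  using n
proof (induction n rule: nat_induct_non_zero)
  case 1
  then show ?case using ideals_set_pow_1[OF P] by simp
next
  case (Suc n)
  then show ?case
    unfolding ideals_set_pow_Suc unit_modulo_prod[OF ideal_ideals_set_pow[OF P] P z] by simp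
qed

section \<open>Counting classes for nested and for coprime ideals\<close>

text \<open>Supplies representatives, chosen inside \<open>S\<close>, of the classes that meet
  \<open>S\<close>.\<close>

lemma rcos_inv_into:
  assumes "Y \<in> (\<lambda>y. I +> y) ` S" "S \<subseteq> carrier R"
  shows "inv_into S (\<lambda>y. I +> y) Y \<in> S" "inv_into S (\<lambda>y. I +> y) Y \<in> carrier R"
    "I +> inv_into S (\<lambda>y. I +> y) Y = Y"
  using inv_into_into[OF assms(1)] f_inv_into_f[OF assms(1)] assms(2) by auto

text \<open>Every class modulo \<open>B\<close> is represented by a unique \<open>y + rx\<close> with \<open>y\<close> modulo \<open>A\<close> and \<open>r\<close> modulo \<open>P\<close>.\<close>

lemma card_cosets_tower:
  assumes id: "ideal A R" "ideal B R" "ideal P R" and BA: "B \<subseteq> A" and x: "x \<in> A"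
    and gen: "\<And>y. y \<in> A \<Longrightarrow> \<exists>r\<in>carrier R. y \<ominus> r \<otimes> x \<in> B"
    and ker: "\<And>r. r \<in> carrier R \<Longrightarrow> r \<otimes> x \<in> B \<longleftrightarrow> r \<in> P"
    and S: "S \<subseteq> carrier R"
    and inv: "\<And>y z. \<lbrakk> y \<in> carrier R; z \<in> carrier R; y \<ominus> z \<in> A; y \<in> S \<rbrakk> \<Longrightarrow> z \<in> S"
  shows "card ((\<lambda>y. B +> y) ` S) = card ((\<lambda>y. A +> y) ` S) * card (carrier (R Quot P))"
proof -
  interpret A: ideal A R by (rule id)
  interpret B: ideal B R by (rule id)
  interpret P: ideal P R by (rule id)
  have xc: "x \<in> carrier R" using x A.Icarr by blast
  let ?CA = "(\<lambda>y. A +> y) ` S" and ?CP = "(\<lambda>y. P +> y) ` carrier R"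
  define ra where "ra = inv_into S (\<lambda>y. A +> y)"
  define rp where "rp = inv_into (carrier R) (\<lambda>y. P +> y)"
  note ra = rcos_inv_into[OF _ S, of _ A, folded ra_def]
  note rp = rcos_inv_into[OF _ subset_refl, of _ P, folded rp_def]
  define z where "z v = ra (fst v) \<oplus> rp (snd v) \<otimes> x" for v
  have zc: "z v \<in> carrier R" if "v \<in> ?CA \<times> ?CP" for v
    using that ra(2)[of "fst v"] rp(2)[of "snd v"] xc by (auto simp: z_def)
  have zA: "z v \<ominus> ra (fst v) \<in> A" if "v \<in> ?CA \<times> ?CP" for v
  proof -
    have *: "ra (fst v) \<in> carrier R" "rp (snd v) \<in> carrier R"
      using that ra(2)[of "fst v"] rp(2)[of "snd v"] by auto
    have "z v \<ominus> ra (fst v) = rp (snd v) \<otimes> x" unfolding z_def using * xc by algebra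
    then show ?thesis using A.I_l_closed[OF x *(2)] by simp
  qed
  have "bij_betw (\<lambda>v. B +> z v) (?CA \<times> ?CP) ((\<lambda>y. B +> y) ` S)"
    unfolding bij_betw_def
  proof (intro conjI inj_onI equalityI subsetI)
    fix v w assume v: "v \<in> ?CA \<times> ?CP" and w: "w \<in> ?CA \<times> ?CP" and "B +> z v = B +> z w"
    then have zB: "z v \<ominus> z w \<in> B"
      using quotient_eq_iff_same_a_r_cos[OF id(2) zc zc] by blast
    have v1: "ra (fst v) \<in> carrier R" "rp (snd v) \<in> carrier R"
      using v ra(2)[of "fst v"] rp(2)[of "snd v"] by auto
    have w1: "ra (fst w) \<in> carrier R" "rp (snd w) \<in> carrier R"
      using w ra(2)[of "fst w"] rp(2)[of "snd w"] by auto
    have "A +> ra (fst v) = A +> z v"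
      using quotient_eq_iff_same_a_r_cos[OF id(1) zc v1(1)] zA v by blast
    also have "\<dots> = A +> z w"
      using quotient_eq_iff_same_a_r_cos[OF id(1) zc zc] zB BA v w by blast
    also have "\<dots> = A +> ra (fst w)"
      using quotient_eq_iff_same_a_r_cos[OF id(1) zc w1(1)] zA w by blast
    finally have 1: "fst v = fst w" using ra(3)[of "fst v"] ra(3)[of "fst w"] v w by auto
    have "z v \<ominus> z w = (rp (snd v) \<ominus> rp (snd w)) \<otimes> x"
      unfolding z_def 1 using w1 v1(2) xc by algebra
    then have "rp (snd v) \<ominus> rp (snd w) \<in> P" using zB ker v1 w1 by simp
    then have "P +> rp (snd v) = P +> rp (snd w)"
      using quotient_eq_iff_same_a_r_cos[OF id(3) v1(2) w1(2)] by blast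
    then have "snd v = snd w" using rp(3)[of "snd v"] rp(3)[of "snd w"] v w by auto
    with 1 show "v = w" by (rule prod_eqI)
  next
    fix Y assume "Y \<in> (\<lambda>v. B +> z v) ` (?CA \<times> ?CP)"
    then obtain v where v: "v \<in> ?CA \<times> ?CP" "Y = B +> z v" by blast
    have v1: "ra (fst v) \<in> S" "ra (fst v) \<in> carrier R"
      using v ra(1,2)[of "fst v"] by auto
    \<comment> \<open>By \<open>inv\<close>, \<open>S\<close> is a union of classes modulo
      \<open>A\<close>, so it contains \<open>z v\<close> along with the representative
      \<open>ra (fst v)\<close>.\<close>
    have "ra (fst v) \<ominus> z v = \<ominus> (z v \<ominus> ra (fst v))" using zc[OF v(1)] v1 by algebra
    then have "ra (fst v) \<ominus> z v \<in> A" using zA[OF v(1)] by simp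
    then have "z v \<in> S" using inv v1 zc[OF v(1)] by blast
    then show "Y \<in> (\<lambda>y. B +> y) ` S" using v(2) by blast
  next
    fix Y assume "Y \<in> (\<lambda>y. B +> y) ` S"
    then obtain y where y: "y \<in> S" "Y = B +> y" by blast
    have yc: "y \<in> carrier R" using y S by blast
    have yA: "A +> y \<in> ?CA" using y by blast
    define y' where "y' = ra (A +> y)"
    have y': "y' \<in> carrier R" "A +> y' = A +> y" unfolding y'_def using ra[OF yA] by auto
    have "y \<ominus> y' \<in> A" using quotient_eq_iff_same_a_r_cos[OF id(1) yc y'(1)] y'(2) by simp
    then obtain r where r: "r \<in> carrier R" "y \<ominus> y' \<ominus> r \<otimes> x \<in> B" using gen by blast
    have rP: "P +> r \<in> ?CP" using r by blast
    define r' where "r' = rp (P +> r)"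
    have r': "r' \<in> carrier R" "P +> r' = P +> r" unfolding r'_def using rp[OF rP] by auto
    have "r \<ominus> r' \<in> P" using quotient_eq_iff_same_a_r_cos[OF id(3) r(1) r'(1)] r'(2) by simp
    then have rx: "(r \<ominus> r') \<otimes> x \<in> B" using ker r r' by simp
    have "y \<ominus> (y' \<oplus> r' \<otimes> x) = (y \<ominus> y' \<ominus> r \<otimes> x) \<oplus> (r \<ominus> r') \<otimes> x"
      using yc y'(1) r(1) r'(1) xc by algebra
    then have "y \<ominus> (y' \<oplus> r' \<otimes> x) \<in> B" using rx r(2) by simp
    then have "Y = B +> z (A +> y, P +> r)"
      unfolding y(2) z_def using quotient_eq_iff_same_a_r_cos[OF id(2) yc] y'(1) r'(1) xc
      by (simp flip: y'_def r'_def)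
    then show "Y \<in> (\<lambda>v. B +> z v) ` (?CA \<times> ?CP)" using yA rP by blast
  qed
  from bij_betw_same_card[OF this] show ?thesis
    by (simp add: card_cartesian_product carrier_Quot)
qed

text \<open>The Chinese remainder theorem restricted to \<open>S\<close> and \<open>T\<close>, which
  are unions of classes modulo \<open>A\<close> and \<open>B\<close> respectively. With
  \<open>\<one> = a \<oplus> b\<close>, the combination of \<open>ra\<close> times \<open>b\<close>
  and \<open>rb\<close> times \<open>a\<close> is congruent to \<open>ra\<close> modulo
  \<open>A\<close> and to \<open>rb\<close> modulo \<open>B\<close>.\<close>

lemma card_cosets_coprime:
  assumes id: "ideal A R" "ideal B R" and AB: "A <+>\<^bsub>R\<^esub> B = carrier R"
    and S: "S \<subseteq> carrier R" "T \<subseteq> carrier R"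
    and invA: "\<And>y z. \<lbrakk> y \<in> carrier R; z \<in> carrier R; y \<ominus> z \<in> A; y \<in> S \<rbrakk> \<Longrightarrow> z \<in> S"
    and invB: "\<And>y z. \<lbrakk> y \<in> carrier R; z \<in> carrier R; y \<ominus> z \<in> B; y \<in> T \<rbrakk> \<Longrightarrow> z \<in> T"
  shows "card ((\<lambda>y. (A \<cdot> B) +> y) ` (S \<inter> T)) = card ((\<lambda>y. A +> y) ` S) * card ((\<lambda>y. B +> y) ` T)"
proof -
  interpret A: ideal A R by (rule id)
  interpret B: ideal B R by (rule id)
  have idAB: "ideal (A \<cdot> B) R" by (rule ideal_prod_is_ideal[OF id])
  have "\<one> \<in> A <+>\<^bsub>R\<^esub> B" using AB by simp
  then obtain a b where ab: "a \<in> A" "b \<in> B" "\<one> = a \<oplus> b" by (rule set_addE)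
  have abc: "a \<in> carrier R" "b \<in> carrier R" using ab by auto
  have b1: "b = \<one> \<ominus> a" unfolding ab(3) using abc by algebra
  \<comment> \<open>For coprime ideals the intersection lies in the product, because c = ac +
    cb.\<close>
  have int: "c \<in> A \<cdot> B" if c: "c \<in> A" "c \<in> B" for c
  proof -
    have "c = a \<otimes> c \<oplus> c \<otimes> b" unfolding b1 using abc A.Icarr[OF c(1)] by algebra
    then show ?thesis using ideal_prod.sum[OF ideal_prod.prod ideal_prod.prod] ab c by metis
  qed
  let ?CA = "(\<lambda>y. A +> y) ` S" and ?CB = "(\<lambda>y. B +> y) ` T"
  define ra where "ra = inv_into S (\<lambda>y. A +> y)"
  define rb where "rb = inv_into T (\<lambda>y. B +> y)"
  note ra = rcos_inv_into[OF _ S(1), of _ A, folded ra_def]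
  note rb = rcos_inv_into[OF _ S(2), of _ B, folded rb_def]
  define z where "z v = ra (fst v) \<otimes> b \<oplus> rb (snd v) \<otimes> a" for v
  have zc: "z v \<in> carrier R" and zA: "ra (fst v) \<ominus> z v \<in> A" and zB: "rb (snd v) \<ominus> z v \<in> B"
    and rv: "ra (fst v) \<in> carrier R" "rb (snd v) \<in> carrier R" "ra (fst v) \<in> S" "rb (snd v) \<in> T"
    and zfst: "A +> z v = fst v" and zsnd: "B +> z v = snd v"
    if v: "v \<in> ?CA \<times> ?CB" for v
  proof -
    show *: "ra (fst v) \<in> carrier R" "rb (snd v) \<in> carrier R"
      and "ra (fst v) \<in> S" "rb (snd v) \<in> T"
      using v ra(1,2)[of "fst v"] rb(1,2)[of "snd v"] by auto
    show zc: "z v \<in> carrier R" using * abc by (simp add: z_def)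
    have "ra (fst v) \<ominus> z v = (ra (fst v) \<ominus> rb (snd v)) \<otimes> a"
      unfolding z_def b1 using * abc by algebra
    then show 1: "ra (fst v) \<ominus> z v \<in> A" using A.I_l_closed ab(1) * by simp
    have a1: "a = \<one> \<ominus> b" unfolding ab(3) using abc by algebra
    have "rb (snd v) \<ominus> z v = (rb (snd v) \<ominus> ra (fst v)) \<otimes> b"
      unfolding z_def a1 using * abc by algebra
    then show 2: "rb (snd v) \<ominus> z v \<in> B" using B.I_l_closed ab(2) * by simp
    show "A +> z v = fst v" using quotient_eq_iff_same_a_r_cos[OF id(1) *(1) zc] 1 ra(3)[of "fst v"] v by auto
    show "B +> z v = snd v" using quotient_eq_iff_same_a_r_cos[OF id(2) *(2) zc] 2 rb(3)[of "snd v"] v by auto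
  qed
  have "bij_betw (\<lambda>v. (A \<cdot> B) +> z v) (?CA \<times> ?CB) ((\<lambda>y. (A \<cdot> B) +> y) ` (S \<inter> T))"
    unfolding bij_betw_def
  proof (intro conjI inj_onI equalityI subsetI)
    fix v w assume v: "v \<in> ?CA \<times> ?CB" and w: "w \<in> ?CA \<times> ?CB" and "(A \<cdot> B) +> z v = (A \<cdot> B) +> z w"
    then have "z v \<ominus> z w \<in> A \<cdot> B"
      using quotient_eq_iff_same_a_r_cos[OF idAB zc zc] by blast
    then have "z v \<ominus> z w \<in> A" "z v \<ominus> z w \<in> B" using ideal_prod_inter[OF id] by auto
    then have "A +> z v = A +> z w" "B +> z v = B +> z w"
      using quotient_eq_iff_same_a_r_cos[OF id(1) zc[OF v] zc[OF w]]
        quotient_eq_iff_same_a_r_cos[OF id(2) zc[OF v] zc[OF w]] by blast+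
    then show "v = w" using zfst zsnd v w by (intro prod_eqI) simp_all
  next
    fix Y assume "Y \<in> (\<lambda>v. (A \<cdot> B) +> z v) ` (?CA \<times> ?CB)"
    then obtain v where v: "v \<in> ?CA \<times> ?CB" "Y = (A \<cdot> B) +> z v" by blast
    have "z v \<in> S" by (rule invA[OF rv(1) zc zA rv(3)]) (rule v(1))+
    moreover have "z v \<in> T" by (rule invB[OF rv(2) zc zB rv(4)]) (rule v(1))+
    ultimately show "Y \<in> (\<lambda>y. (A \<cdot> B) +> y) ` (S \<inter> T)" using v(2) by blast
  next
    fix Y assume "Y \<in> (\<lambda>y. (A \<cdot> B) +> y) ` (S \<inter> T)"
    then obtain y where y: "y \<in> S" "y \<in> T" "Y = (A \<cdot> B) +> y" by blast
    have yc: "y \<in> carrier R" using y S by blast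
    have v: "(A +> y, B +> y) \<in> ?CA \<times> ?CB" using y by blast
    let ?z = "z (A +> y, B +> y)"
    have "y \<ominus> ?z \<in> A" using quotient_eq_iff_same_a_r_cos[OF id(1) yc zc[OF v]] zfst[OF v] by simp
    moreover have "y \<ominus> ?z \<in> B" using quotient_eq_iff_same_a_r_cos[OF id(2) yc zc[OF v]] zsnd[OF v] by simp
    ultimately have "y \<ominus> ?z \<in> A \<cdot> B" by (rule int)
    then have "Y = (A \<cdot> B) +> ?z" using quotient_eq_iff_same_a_r_cos[OF idAB yc zc[OF v]] y(3) by simp
    then show "Y \<in> (\<lambda>v. (A \<cdot> B) +> z v) ` (?CA \<times> ?CB)" using v by blast
  qed
  from bij_betw_same_card[OF this] show ?thesis by (simp add: card_cartesian_product)
qed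

end

lemma (in cring) finite_Quot_mono:
  assumes id: "ideal I R" "ideal J R" and IJ: "I \<subseteq> J" and fin: "finite (carrier (R Quot I))"
  shows "finite (carrier (R Quot J))"
proof -
  define rep where "rep = inv_into (carrier R) (\<lambda>y. I +> y)"
  have "carrier (R Quot J) \<subseteq> (\<lambda>Y. J +> rep Y) ` carrier (R Quot I)"
  proof
    fix Z assume "Z \<in> carrier (R Quot J)"
    then obtain y where y: "y \<in> carrier R" "Z = J +> y" by (auto simp: carrier_Quot)
    have Y: "I +> y \<in> (\<lambda>y. I +> y) ` carrier R" using y by blast
    note r = rcos_inv_into[OF Y subset_refl, folded rep_def]
    have "y \<ominus> rep (I +> y) \<in> I"
      using quotient_eq_iff_same_a_r_cos[OF id(1) y(1) r(2)] r(3) by simp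
    then have "Z = J +> rep (I +> y)"
      using quotient_eq_iff_same_a_r_cos[OF id(2) y(1) r(2)] IJ y(2) by blast
    then show "Z \<in> (\<lambda>Y. J +> rep Y) ` carrier (R Quot I)" using Y by (auto simp: carrier_Quot)
  qed
  then show ?thesis using fin finite_surj by blast
qed

text \<open>The elements of \<open>T\<close> occupy \<open>card T\<close> different classes modulo
  \<open>P\<close>, and the remaining classes are those counted. The inequality selects the branch
  \<open>r \<le> q\<close> of the rule \<open>prime_power\<close> and makes the subtraction of
  naturals a true one.\<close>

lemma (in cring) card_avoiding_cosets:
  assumes P: "ideal P R" and fin: "finite (carrier (R Quot P))"
    and T: "T \<subseteq> carrier R" "pairwise (\<lambda>s t. s \<ominus> t \<notin> P) T"
  shows "card T \<le> card (carrier (R Quot P))"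
    and "card ((\<lambda>y. P +> y) ` {y \<in> carrier R. \<forall>t\<in>T. y \<ominus> t \<notin> P}) = card (carrier (R Quot P)) - card T"
proof -
  have inj: "inj_on (\<lambda>y. P +> y) T"
    using T quotient_eq_iff_same_a_r_cos[OF P] unfolding inj_on_def pairwise_def by blast
  have sub: "(\<lambda>y. P +> y) ` T \<subseteq> carrier (R Quot P)" using T by (auto simp: carrier_Quot)
  show "card T \<le> card (carrier (R Quot P))"
    using card_mono[OF fin sub] card_image[OF inj] by simp
  have "(\<lambda>y. P +> y) ` {y \<in> carrier R. \<forall>t\<in>T. y \<ominus> t \<notin> P}
      = carrier (R Quot P) - (\<lambda>y. P +> y) ` T"
    unfolding carrier_Quot
  proof (intro equalityI subsetI)
    fix Y assume "Y \<in> (\<lambda>y. P +> y) ` {y \<in> carrier R. \<forall>t\<in>T. y \<ominus> t \<notin> P}"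
    then obtain y where y: "y \<in> carrier R" "Y = P +> y" "\<forall>t\<in>T. y \<ominus> t \<notin> P" by blast
    then have "P +> y \<noteq> P +> t" if "t \<in> T" for t
      using quotient_eq_iff_same_a_r_cos[OF P y(1), of t] T(1) that by blast
    then show "Y \<in> (\<lambda>y. P +> y) ` carrier R - (\<lambda>y. P +> y) ` T" using y by blast
  next
    fix Y assume "Y \<in> (\<lambda>y. P +> y) ` carrier R - (\<lambda>y. P +> y) ` T"
    then obtain y where y: "y \<in> carrier R" "Y = P +> y" "Y \<notin> (\<lambda>y. P +> y) ` T" by blast
    have "y \<ominus> t \<notin> P" if "t \<in> T" for t
    proof
      assume "y \<ominus> t \<in> P"
      then have "P +> y = P +> t"
        using quotient_eq_iff_same_a_r_cos[OF P y(1), of t] T(1) that by blast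
      then show False using y that by blast
    qed
    then show "Y \<in> (\<lambda>y. P +> y) ` {y \<in> carrier R. \<forall>t\<in>T. y \<ominus> t \<notin> P}" using y by blast
  qed
  then show "card ((\<lambda>y. P +> y) ` {y \<in> carrier R. \<forall>t\<in>T. y \<ominus> t \<notin> P}) = card (carrier (R Quot P)) - card T"
    using card_Diff_subset[OF finite_subset[OF sub fin] sub] card_image[OF inj] by simp
qed

section \<open>Successive quotients of powers of a prime\<close>

context dedekind_domain
begin

lemma prime_power_nonzero:
  fixes n :: nat
  assumes P: "ideal P R" "P \<noteq> {\<zero>}"
  shows "P [^]\<^bsub>ideals_set R\<^esub> n \<noteq> {\<zero>}"
proof -
  interpret P: ideal P R by (rule P(1))
  obtain c where c: "c \<in> P" "c \<noteq> \<zero>" using P(2) P.zero_closed by blast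
  have "\<exists>x\<in>P [^]\<^bsub>ideals_set R\<^esub> n. x \<noteq> \<zero>"
  proof (induction n)
    case 0
    then show ?case using one_closed one_not_zero unfolding ideals_set_pow_0 by blast
  next
    case (Suc n)
    then obtain x where x: "x \<in> P [^]\<^bsub>ideals_set R\<^esub> n" "x \<noteq> \<zero>" by blast
    have "x \<in> carrier R" by (rule ideal.Icarr[OF ideal_ideals_set_pow[OF P(1)] x(1)])
    then have "x \<otimes> c \<noteq> \<zero>" using integral_iff x(2) c P.Icarr by simp
    moreover have "x \<otimes> c \<in> (P [^]\<^bsub>ideals_set R\<^esub> n) \<cdot> P" by (rule ideal_prod.prod[OF x(1) c(1)])
    ultimately show ?case unfolding ideals_set_pow_Suc by blast
  qed
  then show ?thesis by blast
qed

text \<open>Since c = cp + c'p' with cp in P^2 for every \<open>c \<in> P\<close>, the element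
  \<open>p'\<close> generates \<open>P\<close> modulo P^2. Accordingly, if \<open>x\<close>
  generates P^n modulo P^(n+1), then \<open>x \<otimes> p'\<close> generates the next quotient; the
  induction starts with \<open>\<one>\<close>.\<close>

lemma prime_power_cyclic:
  fixes n :: nat
  assumes P: "primeideal P R" "P \<noteq> {\<zero>}"
  shows "\<exists>x\<in>P [^]\<^bsub>ideals_set R\<^esub> n. \<forall>y\<in>P [^]\<^bsub>ideals_set R\<^esub> n. \<exists>r\<in>carrier R.
    y \<ominus> r \<otimes> x \<in> P [^]\<^bsub>ideals_set R\<^esub> Suc n"
proof -
  interpret P: primeideal P R by (rule P(1))
  obtain a b p p' where ab: "a \<in> carrier R" "a \<noteq> \<zero>" "b \<in> carrier R" "p \<in> P" "p' \<in> P"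
    "a = a \<otimes> p \<oplus> b \<otimes> p'" and bP: "\<And>c. c \<in> P \<Longrightarrow> \<exists>c'\<in>carrier R. b \<otimes> c = a \<otimes> c'"
    using prime_ideal_invertible[OF P] by metis
  have pc: "p \<in> carrier R" "p' \<in> carrier R" using ab P.Icarr by auto
  have split: "\<exists>c'\<in>carrier R. c = c \<otimes> p \<oplus> c' \<otimes> p'" if c: "c \<in> P" for c
  proof -
    have cc: "c \<in> carrier R" using c P.Icarr by blast
    obtain c' where c': "c' \<in> carrier R" "b \<otimes> c = a \<otimes> c'" using bP[OF c] by blast
    have "a \<otimes> c = (a \<otimes> p \<oplus> b \<otimes> p') \<otimes> c" using ab by simp
    also have "\<dots> = a \<otimes> (c \<otimes> p) \<oplus> (b \<otimes> c) \<otimes> p'" using cc pc ab(1,3) by algebra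
    also have "\<dots> = a \<otimes> (c \<otimes> p \<oplus> c' \<otimes> p')"
      unfolding c'(2) using cc pc c'(1) ab(1,3) by algebra
    finally have "c = c \<otimes> p \<oplus> c' \<otimes> p'" using m_lcancel[OF ab(2,1)] c' cc pc by simp
    then show ?thesis using c' by blast
  qed
  let ?Q = "\<lambda>n::nat. P [^]\<^bsub>ideals_set R\<^esub> n"
  note Qid = ideal_ideals_set_pow[OF P.is_ideal]
  have Qc: "y \<in> carrier R" if "y \<in> ?Q k" for y k using ideal.Icarr[OF Qid that] .
  show ?thesis
  proof (induction n)
    case 0
    have "y \<ominus> y \<otimes> \<one> \<in> ?Q (Suc 0)" if "y \<in> carrier R" for y
    proof -
      have "y \<ominus> y \<otimes> \<one> = \<zero>" using that by algebra
      then show ?thesis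
        using additive_subgroup.zero_closed[OF ideal.axioms(1)[OF Qid[of "Suc 0"]]]
        by (simp only:)
    qed
    then show ?case unfolding ideals_set_pow_0 by blast
  next
    case (Suc n)
    then obtain x where x: "x \<in> ?Q n" "\<And>y. y \<in> ?Q n \<Longrightarrow> \<exists>r\<in>carrier R. y \<ominus> r \<otimes> x \<in> ?Q (Suc n)"
      by blast
    interpret Q1: ideal "?Q (Suc n)" R by (rule Qid)
    interpret Q2: ideal "?Q (Suc (Suc n))" R by (rule Qid)
    have xc: "x \<in> carrier R" by (rule Qc[OF x(1)])
    have "\<exists>r\<in>carrier R. z \<ominus> r \<otimes> (x \<otimes> p') \<in> ?Q (Suc (Suc n))" if "z \<in> ?Q n \<cdot> P" for z
      using that
    proof induction
      case (prod y c)
      have yc: "y \<in> carrier R" "c \<in> carrier R" using Qc prod P.Icarr by auto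
      obtain r where r: "r \<in> carrier R" "y \<ominus> r \<otimes> x \<in> ?Q (Suc n)" using x(2) prod by blast
      obtain c' where c': "c' \<in> carrier R" "c = c \<otimes> p \<oplus> c' \<otimes> p'" using split prod by blast
      have "y \<otimes> c \<in> ?Q (Suc n)" unfolding ideals_set_pow_Suc by (rule ideal_prod.prod[OF prod])
      then have 1: "(y \<otimes> c) \<otimes> p \<in> ?Q (Suc (Suc n))"
        unfolding ideals_set_pow_Suc[of P "Suc n"] by (rule ideal_prod.prod[OF _ ab(4)])
      have "(y \<ominus> r \<otimes> x) \<otimes> c' \<in> ?Q (Suc n)" using Q1.I_r_closed r c' by blast
      then have 2: "((y \<ominus> r \<otimes> x) \<otimes> c') \<otimes> p' \<in> ?Q (Suc (Suc n))"
        unfolding ideals_set_pow_Suc[of P "Suc n"] by (rule ideal_prod.prod[OF _ ab(5)])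
      \<comment> \<open>The coefficient \<open>r \<otimes> c'\<close> is chosen so that the
        difference splits into \<open>(y \<otimes> c) \<otimes> p\<close> and a multiple of
        \<open>y \<ominus> r \<otimes> x\<close> times \<open>p'\<close>. In each, a factor from
        P^(n+1) meets one from \<open>P\<close>.\<close>
      have "y \<otimes> c \<ominus> (r \<otimes> c') \<otimes> (x \<otimes> p') = y \<otimes> (c \<otimes> p \<oplus> c' \<otimes> p') \<ominus> (r \<otimes> c') \<otimes> (x \<otimes> p')"
        using c'(2) by simp
      also have "\<dots> = (y \<otimes> c) \<otimes> p \<oplus> ((y \<ominus> r \<otimes> x) \<otimes> c') \<otimes> p'"
        using yc r(1) xc pc c'(1) by algebra
      finally have "y \<otimes> c \<ominus> (r \<otimes> c') \<otimes> (x \<otimes> p') \<in> ?Q (Suc (Suc n))"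
        using Q2.a_closed[OF 1 2] by simp
      then show ?case using r c' by blast
    next
      case (sum s t)
      have st: "s \<in> carrier R" "t \<in> carrier R"
        using sum ideal_prod_in_carrier[OF Qid P.is_ideal] by auto
      obtain r r' where r: "r \<in> carrier R" "s \<ominus> r \<otimes> (x \<otimes> p') \<in> ?Q (Suc (Suc n))"
        "r' \<in> carrier R" "t \<ominus> r' \<otimes> (x \<otimes> p') \<in> ?Q (Suc (Suc n))" using sum by blast
      have "(s \<oplus> t) \<ominus> (r \<oplus> r') \<otimes> (x \<otimes> p') = (s \<ominus> r \<otimes> (x \<otimes> p')) \<oplus> (t \<ominus> r' \<otimes> (x \<otimes> p'))"
        using st r(1,3) xc pc by algebra
      then have "(s \<oplus> t) \<ominus> (r \<oplus> r') \<otimes> (x \<otimes> p') \<in> ?Q (Suc (Suc n))"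
        using Q2.a_closed[OF r(2,4)] by simp
      then show ?case using r by blast
    qed
    moreover have "x \<otimes> p' \<in> ?Q n \<cdot> P" by (rule ideal_prod.prod[OF x(1) ab(5)])
    ultimately show ?case unfolding ideals_set_pow_Suc[of P n] by blast
  qed
qed

text \<open>For a generator \<open>x\<close> of P^n modulo P^(n+1), the map sending \<open>r\<close>
  to the class of rx has kernel exactly \<open>P\<close>. This puts the two powers into the setting
  of \<open>card_cosets_tower\<close>.\<close>

lemma card_cosets_prime_power_Suc:
  fixes n :: nat
  assumes P: "primeideal P R" "P \<noteq> {\<zero>}" and n: "n > 0" and S: "S \<subseteq> carrier R"
    and inv: "\<And>y z. \<lbrakk> y \<in> carrier R; z \<in> carrier R; y \<ominus> z \<in> P; y \<in> S \<rbrakk> \<Longrightarrow> z \<in> S"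
  shows "card ((\<lambda>y. (P [^]\<^bsub>ideals_set R\<^esub> Suc n) +> y) ` S)
    = card ((\<lambda>y. (P [^]\<^bsub>ideals_set R\<^esub> n) +> y) ` S) * card (carrier (R Quot P))"
proof -
  interpret P: maximalideal P R by (rule nonzero_prime_maximal[OF P])
  let ?Q = "\<lambda>n::nat. P [^]\<^bsub>ideals_set R\<^esub> n"
  note Qid = ideal_ideals_set_pow[OF P.is_ideal]
  obtain x where x: "x \<in> ?Q n" "\<And>y. y \<in> ?Q n \<Longrightarrow> \<exists>r\<in>carrier R. y \<ominus> r \<otimes> x \<in> ?Q (Suc n)"
    using prime_power_cyclic[OF P] by blast
  have xc: "x \<in> carrier R" by (rule ideal.Icarr[OF Qid x(1)])
  interpret Q: ideal "?Q (Suc n)" R by (rule Qid)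
  have sub: "?Q (Suc n) \<subseteq> ?Q n"
    unfolding ideals_set_pow_Suc using ideal_prod_inter[OF Qid P.is_ideal] by blast
  \<comment> \<open>Here \<open>n > 0\<close> matters: a set closed under congruence modulo
    \<open>P\<close> is then also closed under congruence modulo P^n.\<close>
  have subP: "?Q n \<subseteq> P"
  proof -
    obtain k where "n = Suc k" using n gr0_implies_Suc by blast
    then show ?thesis using ideal_prod_inter[OF Qid P.is_ideal] ideals_set_pow_Suc by auto
  qed
  \<comment> \<open>A generator inside P^(n+1) would force P^n = P^(n+1), against
    \<open>prime_mult_ideal_neq\<close>.\<close>
  have xn: "x \<notin> ?Q (Suc n)"
  proof
    assume xQ: "x \<in> ?Q (Suc n)"
    have "y \<in> ?Q (Suc n)" if y: "y \<in> ?Q n" for y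
    proof -
      obtain r where r: "r \<in> carrier R" "y \<ominus> r \<otimes> x \<in> ?Q (Suc n)" using x(2) y by blast
      have "y = (y \<ominus> r \<otimes> x) \<oplus> r \<otimes> x" using ideal.Icarr[OF Qid y] r(1) xc by algebra
      then show ?thesis using Q.a_closed[OF r(2) Q.I_l_closed[OF xQ r(1)]] by simp
    qed
    then have "?Q (Suc n) = ?Q n" using sub by blast
    then have "P \<cdot> ?Q n = ?Q n"
      unfolding ideals_set_pow_Suc using ideal_prod_commute[OF Qid P.is_ideal] by simp
    then show False
      using prime_mult_ideal_neq[OF P Qid prime_power_nonzero[OF P.is_ideal P(2)]] by blast
  qed
  have ker: "r \<otimes> x \<in> ?Q (Suc n) \<longleftrightarrow> r \<in> P" if r: "r \<in> carrier R" for r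
  proof
    assume "r \<in> P"
    then have "x \<otimes> r \<in> ?Q n \<cdot> P" by (rule ideal_prod.prod[OF x(1)])
    then show "r \<otimes> x \<in> ?Q (Suc n)" using m_comm[OF xc r] unfolding ideals_set_pow_Suc by simp
  next
    assume rx: "r \<otimes> x \<in> ?Q (Suc n)"
    show "r \<in> P"
    proof (rule ccontr)
      assume "r \<notin> P"
      then obtain u where u: "u \<in> carrier R" "u \<otimes> r \<ominus> \<one> \<in> P"
        using P.exists_inverse_modulo[OF is_cring r] by blast
      have "x \<otimes> (u \<otimes> r \<ominus> \<one>) \<in> ?Q (Suc n)"
        unfolding ideals_set_pow_Suc by (rule ideal_prod.prod[OF x(1) u(2)])
      moreover have "u \<otimes> (r \<otimes> x) \<in> ?Q (Suc n)" by (rule Q.I_l_closed[OF rx u(1)])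
      moreover have "x = u \<otimes> (r \<otimes> x) \<ominus> x \<otimes> (u \<otimes> r \<ominus> \<one>)" using xc r u(1) by algebra
      ultimately show False using Q.minus_mem xn by metis
    qed
  qed
  show ?thesis
    by (rule card_cosets_tower[OF Qid Qid P.is_ideal sub x ker S]) (use inv subP in blast)+
qed

lemma card_cosets_prime_power:
  fixes n :: nat
  assumes P: "primeideal P R" "P \<noteq> {\<zero>}" and n: "n > 0" and S: "S \<subseteq> carrier R"
    and inv: "\<And>y z. \<lbrakk> y \<in> carrier R; z \<in> carrier R; y \<ominus> z \<in> P; y \<in> S \<rbrakk> \<Longrightarrow> z \<in> S"
  shows "card ((\<lambda>y. (P [^]\<^bsub>ideals_set R\<^esub> n) +> y) ` S)
    = card (carrier (R Quot P)) ^ (n - 1) * card ((\<lambda>y. P +> y) ` S)"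
  using n
proof (induction n rule: nat_induct_non_zero)
  case 1
  then show ?case using ideals_set_pow_1[OF primeideal.axioms(1)[OF P(1)]] by simp
next
  case (Suc n)
  have "card (carrier (R Quot P)) ^ n
      = card (carrier (R Quot P)) ^ (n - 1) * card (carrier (R Quot P))"
    using Suc(1) by (metis Suc_diff_1 power_Suc2)
  moreover have "card ((\<lambda>y. (P [^]\<^bsub>ideals_set R\<^esub> Suc n) +> y) ` S)
      = card ((\<lambda>y. (P [^]\<^bsub>ideals_set R\<^esub> n) +> y) ` S) * card (carrier (R Quot P))"
    by (rule card_cosets_prime_power_Suc[OF P Suc(1) S]) (rule inv)
  ultimately show ?case unfolding Suc.IH by (simp only: diff_Suc_1 mult_ac)
qed

section \<open>Factorisation of ideals and the values of S_r\<close>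

text \<open>Splits off the whole \<open>P\<close>-part. The colon ideal (I : P) is strictly larger
  than \<open>I\<close>, so repeated division by \<open>P\<close> stops. Recording
  \<open>I \<subseteq> B\<close> lets \<open>B\<close> inherit nonvanishing and finite index from
  \<open>I\<close>.\<close>

lemma prime_power_factor:
  assumes P: "primeideal P R" "P \<noteq> {\<zero>}" and I: "ideal I R"
  shows "I \<subseteq> P \<Longrightarrow> I \<noteq> {\<zero>} \<Longrightarrow>
    \<exists>k B. ideal B R \<and> I \<subseteq> B \<and> \<not> B \<subseteq> P \<and> I = (P [^]\<^bsub>ideals_set R\<^esub> Suc k) \<cdot> B"
  using I
proof (induction rule: noetherian_ideal_induct)
  case (step I)
  interpret P: primeideal P R by (rule P(1))
  interpret I: ideal I R by (rule step(1))
  note Qid = ideal_ideals_set_pow[OF P.is_ideal]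
  define C where "C = {c \<in> carrier R. \<forall>d\<in>P. c \<otimes> d \<in> I}"
  have C: "ideal C R" unfolding C_def by (rule ideal_colon[OF step(1) P.is_ideal])
  have I_eq: "I = P \<cdot> C" unfolding C_def by (rule prime_dvd_ideal[OF P step(1,3)])
  have IC: "I \<subseteq> C" unfolding C_def using I.Icarr P.Icarr I.I_r_closed by blast
  have "I \<noteq> C" using prime_mult_ideal_neq[OF P step(1,4)] I_eq by metis
  show ?case
  proof (cases "C \<subseteq> P")
    case True
    have "C \<noteq> {\<zero>}" using IC step(4) I.zero_closed by blast
    then obtain k B where B: "ideal B R" "C \<subseteq> B" "\<not> B \<subseteq> P"
        "C = (P [^]\<^bsub>ideals_set R\<^esub> Suc k) \<cdot> B"
      using step(2)[OF C] IC \<open>I \<noteq> C\<close> True by blast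
    have "I = (P \<cdot> (P [^]\<^bsub>ideals_set R\<^esub> Suc k)) \<cdot> B"
      using I_eq B(4) ideal_prod_assoc[OF P.is_ideal Qid B(1)] by metis
    also have "\<dots> = (P [^]\<^bsub>ideals_set R\<^esub> Suc (Suc k)) \<cdot> B"
      using ideal_prod_commute[OF P.is_ideal Qid] ideals_set_pow_Suc[of P "Suc k"] by metis
    finally show ?thesis using B IC by blast
  next
    case False
    then show ?thesis using C IC I_eq ideals_set_pow_1[OF P.is_ideal] by metis
  qed
qed

text \<open>Splitting off the power of one prime above \<open>I\<close> leaves a cofactor
  \<open>B\<close> strictly larger than \<open>I\<close>, since \<open>B\<close> is not contained in
  that prime. The induction hypothesis treats \<open>B\<close>, and the rule for coprime products
  joins the two.\<close>

lemma schemmel_rel_exists: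
  assumes I: "ideal I R"
  shows "I \<noteq> {\<zero>} \<Longrightarrow> finite (carrier (R Quot I)) \<Longrightarrow> \<exists>s. schemmel_rel R r I s"
  using I
proof (induction rule: noetherian_ideal_induct)
  case (step I)
  interpret I: ideal I R by (rule step(1))
  show ?case
  proof (cases "I = carrier R")
    case True
    then show ?thesis using schemmel_rel.unit_ideal by blast
  next
    case False
    then obtain P where P: "maximalideal P R" "I \<subseteq> P"
      using exists_maximalideal_containing[OF step(1)] by blast
    interpret P: maximalideal P R by (rule P(1))
    have prime: "primeideal P R" by (rule maximalideal_prime[OF P(1)])
    have P0: "P \<noteq> {\<zero>}" using P(2) step(3) I.zero_closed by blast
    have finP: "finite (carrier (R Quot P))"
      by (rule finite_Quot_mono[OF step(1) P.is_ideal P(2) step(4)])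
    obtain k B where B: "ideal B R" "I \<subseteq> B" "\<not> B \<subseteq> P"
      and I_eq: "I = (P [^]\<^bsub>ideals_set R\<^esub> Suc k) \<cdot> B"
      using prime_power_factor[OF prime P0 step(1) P(2) step(3)] by blast
    let ?Q = "P [^]\<^bsub>ideals_set R\<^esub> Suc k"
    have Q: "ideal ?Q R" by (rule ideal_ideals_set_pow[OF P.is_ideal])
    have B0: "B \<noteq> {\<zero>}" using B(2) step(3) I.zero_closed by blast
    have finB: "finite (carrier (R Quot B))"
      by (rule finite_Quot_mono[OF step(1) B(1,2) step(4)])
    have "I \<subseteq> ?Q" using I_eq ideal_prod_inter[OF Q B(1)] by blast
    then have finQ: "finite (carrier (R Quot ?Q))"
      by (rule finite_Quot_mono[OF step(1) Q _ step(4)])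
    have Q0: "?Q \<noteq> {\<zero>}" by (rule prime_power_nonzero[OF P.is_ideal P0])
    \<comment> \<open>An element \<open>z\<close> of \<open>B\<close> outside \<open>P\<close> is a
      unit modulo \<open>P\<close>, hence modulo the power \<open>?Q\<close>. With \<open>u\<close>
      its inverse, uz \<in> \<open>B\<close> and uz - 1 \<in> \<open>?Q\<close> place
      \<open>\<one>\<close> in the sum.\<close>
    have "?Q <+>\<^bsub>R\<^esub> B = carrier R"
    proof -
      interpret QB: ideal "?Q <+>\<^bsub>R\<^esub> B" R by (rule add_ideals[OF Q B(1)])
      obtain z where z: "z \<in> B" "z \<notin> P" using B(3) by blast
      have zc: "z \<in> carrier R" by (rule ideal.Icarr[OF B(1) z(1)])
      have "unit_modulo R ?Q z"
        using unit_modulo_pow[OF P.is_ideal zc] unit_modulo_maximalideal[OF P(1) zc] z by blast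
      then obtain u where u: "u \<in> carrier R" "u \<otimes> z \<ominus> \<one> \<in> ?Q" unfolding unit_modulo_def by blast
      have "u \<otimes> z \<in> ?Q <+>\<^bsub>R\<^esub> B" "u \<otimes> z \<ominus> \<one> \<in> ?Q <+>\<^bsub>R\<^esub> B"
        using subset_set_add1[OF Q B(1)] subset_set_add2[OF Q B(1)] ideal.I_l_closed[OF B(1) z(1) u(1)] u(2)
        by auto
      then have "\<one> \<in> ?Q <+>\<^bsub>R\<^esub> B"
        using ideal_mem_cong[OF QB.is_ideal _ one_closed] u(1) zc by blast
      then show ?thesis by (rule QB.one_imp_carrier)
    qed
    moreover obtain t where "schemmel_rel R r B t"
      using step(2)[OF B(1)] B B0 finB P(2) by blast
    moreover obtain s where "schemmel_rel R r ?Q s"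
      using schemmel_rel.prime_power[OF prime P0 finP zero_less_Suc refl] by blast
    ultimately have "schemmel_rel R r (?Q \<cdot> B) (s * t)"
      using schemmel_rel.coprime_product Q Q0 finQ B(1) B0 finB by blast
    then show ?thesis using I_eq by metis
  qed
qed

text \<open>Each defining rule of S_r mirrors a count of classes. As the count does not mention the
  derivation, all values derivable for \<open>I\<close> and \<open>r\<close> agree as soon as a
  suitable \<open>T\<close> exists.\<close>

lemma card_schemmel_rel:
  assumes "schemmel_rel R r I s"
    and "T \<subseteq> carrier R" "finite T" "card T = r" "pairwise (\<lambda>t t'. unit_modulo R I (t \<ominus> t')) T"
  shows "card ((\<lambda>y. I +> y) ` {y \<in> carrier R. \<forall>t\<in>T. unit_modulo R I (y \<ominus> t)}) = s"
  using assms
proof (induction rule: schemmel_rel.induct)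
  case unit_ideal
  \<comment> \<open>The quotient is the zero ring, whose single element is a unit, so exactly one
    class is counted.\<close>
  have "{y \<in> carrier R. \<forall>t\<in>T. unit_modulo R (carrier R) (y \<ominus> t)} = carrier R"
    using unit_ideal unit_modulo_carrier by auto
  moreover have "(\<lambda>y. carrier R +> y) ` carrier R = {carrier R}"
    using a_rcos_zero[OF oneideal] one_closed by auto
  ultimately show ?case by simp
next
  case (prime_power P \<alpha> q)
  interpret P: primeideal P R by (rule prime_power)
  have max: "maximalideal P R" by (rule nonzero_prime_maximal) fact+
  have unit: "unit_modulo R (P [^]\<^bsub>ideals_set R\<^esub> \<alpha>) (y \<ominus> t) \<longleftrightarrow> y \<ominus> t \<notin> P"
    if "y \<in> carrier R" "t \<in> T" for y t
    using unit_modulo_pow[OF P.is_ideal _ \<open>\<alpha> > 0\<close>] unit_modulo_maximalideal[OF max]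
      that prime_power(6) by auto
  have pw: "pairwise (\<lambda>s t. s \<ominus> t \<notin> P) T"
    using prime_power(6,9) unit unfolding pairwise_def by blast
  let ?S = "{y \<in> carrier R. \<forall>t\<in>T. y \<ominus> t \<notin> P}"
  have S: "{y \<in> carrier R. \<forall>t\<in>T. unit_modulo R (P [^]\<^bsub>ideals_set R\<^esub> \<alpha>) (y \<ominus> t)} = ?S"
    using unit by blast
  have "card ((\<lambda>y. (P [^]\<^bsub>ideals_set R\<^esub> \<alpha>) +> y) ` ?S)
      = card (carrier (R Quot P)) ^ (\<alpha> - 1) * card ((\<lambda>y. P +> y) ` ?S)"
  proof (rule card_cosets_prime_power)
    fix y z assume yz: "y \<in> carrier R" "z \<in> carrier R" "y \<ominus> z \<in> P" "y \<in> ?S"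
    have "z \<ominus> t \<notin> P" if t: "t \<in> T" for t
    proof -
      have tc: "t \<in> carrier R" using t prime_power(6) by blast
      have "(y \<ominus> t) \<ominus> (z \<ominus> t) = y \<ominus> z" using yz(1,2) tc by algebra
      then have "y \<ominus> t \<in> P \<longleftrightarrow> z \<ominus> t \<in> P"
        using yz tc by (intro ideal_mem_cong[OF P.is_ideal]) simp_all
      then show ?thesis using yz(4) t by blast
    qed
    then show "z \<in> ?S" using yz by blast
  qed (use prime_power in auto)
  moreover note card_avoiding_cosets[OF P.is_ideal prime_power(3,6) pw]
  ultimately show ?case unfolding S using prime_power(5,8) by simp
next
  case (coprime_product A B s t)
  interpret A: ideal A R by fact
  interpret B: ideal B R by fact
  have Tc: "t \<in> carrier R" if "t \<in> T" for t using that coprime_product by blast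
  let ?S = "\<lambda>A. {y \<in> carrier R. \<forall>t\<in>T. unit_modulo R A (y \<ominus> t)}"
  have inv: "z \<in> ?S C" if C: "ideal C R" and yz: "y \<in> carrier R" "z \<in> carrier R" "y \<ominus> z \<in> C" "y \<in> ?S C"
    for C y z
  proof -
    have "unit_modulo R C (z \<ominus> t)" if t: "t \<in> T" for t
    proof -
      have "(y \<ominus> t) \<ominus> (z \<ominus> t) = y \<ominus> z" using yz(1,2) Tc[OF t] by algebra
      then have "unit_modulo R C (y \<ominus> t) \<longleftrightarrow> unit_modulo R C (z \<ominus> t)"
        using yz Tc[OF t] by (intro unit_modulo_cong[OF C]) simp_all
      then show ?thesis using yz(4) t by blast
    qed
    then show ?thesis using yz by blast
  qed
  have unit: "unit_modulo R (A \<cdot> B) (y \<ominus> t) \<longleftrightarrow> unit_modulo R A (y \<ominus> t) \<and> unit_modulo R B (y \<ominus> t)"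
    if "y \<in> carrier R" "t \<in> T" for y t
    using unit_modulo_prod[OF A.is_ideal B.is_ideal] that Tc by simp
  have S: "?S (A \<cdot> B) = ?S A \<inter> ?S B" using unit by blast
  \<comment> \<open>By \<open>unit\<close>, differences that are units modulo AB are units modulo
    each factor, so \<open>T\<close> meets the premises of both induction hypotheses.\<close>
  have "card ((\<lambda>y. A +> y) ` ?S A) = s" "card ((\<lambda>y. B +> y) ` ?S B) = t"
    using coprime_product.IH coprime_product.prems unit Tc unfolding pairwise_def by blast+
  moreover have "card ((\<lambda>y. (A \<cdot> B) +> y) ` (?S A \<inter> ?S B))
      = card ((\<lambda>y. A +> y) ` ?S A) * card ((\<lambda>y. B +> y) ` ?S B)"
    by (rule card_cosets_coprime[OF A.is_ideal B.is_ideal])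
      (use coprime_product(7) inv A.is_ideal B.is_ideal in blast)+
  ultimately show ?case unfolding S by simp
qed

end

section \<open>Counting cliques\<close>

text \<open>Counts the cliques of order \<open>Suc n\<close> with a marked vertex: deleting that
  vertex leaves a clique of order \<open>n\<close> together with a common neighbour. Without loops a
  common neighbour is never in the clique itself, so insertion inverts deletion.\<close>

lemma card_cliques_Suc:
  assumes V: "finite V" and loops: "\<And>v. v \<in> V \<Longrightarrow> {v, v} \<notin> E"
    and ext: "\<And>C. C \<in> cliques V E n \<Longrightarrow> card {v \<in> V. \<forall>c\<in>C. {v, c} \<in> E} = s"
  shows "Suc n * card (cliques V E (Suc n)) = card (cliques V E n) * s"
proof -
  let ?ext = "\<lambda>C. {v \<in> V. \<forall>c\<in>C. {v, c} \<in> E}"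
  have fin: "finite (cliques V E k)" for k
    by (rule finite_subset[of _ "Pow V"]) (use V in \<open>auto simp: cliques_def\<close>)
  have notin: "v \<notin> C" if "v \<in> ?ext C" for v C using that loops by blast
  have "bij_betw (\<lambda>(C, v). (C - {v}, v)) (SIGMA C:cliques V E (Suc n). C) (SIGMA C:cliques V E n. ?ext C)"
  proof (rule bij_betw_byWitness[where f' = "\<lambda>(C, v). (insert v C, v)"])
    show "(\<lambda>(C, v). (C - {v}, v)) ` (SIGMA C:cliques V E (Suc n). C) \<subseteq> (SIGMA C:cliques V E n. ?ext C)"
      by (fastforce simp: cliques_def pairwise_def)
    have "insert v C \<in> cliques V E (Suc n)" if "C \<in> cliques V E n" "v \<in> ?ext C" for C v
      using that notin[OF that(2)] unfolding cliques_def by (auto simp: pairwise_insert insert_commute)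
    then show "(\<lambda>(C, v). (insert v C, v)) ` (SIGMA C:cliques V E n. ?ext C) \<subseteq> (SIGMA C:cliques V E (Suc n). C)"
      by auto
    show "\<forall>a\<in>(SIGMA C:cliques V E n. ?ext C). (\<lambda>(C, v). (C - {v}, v)) ((\<lambda>(C, v). (insert v C, v)) a) = a"
    proof
      fix a assume "a \<in> (SIGMA C:cliques V E n. ?ext C)"
      then obtain C v where a: "a = (C, v)" "v \<in> ?ext C" by (elim SigmaE)
      have "v \<notin> C" by (rule notin[OF a(2)])
      then show "(\<lambda>(C, v). (C - {v}, v)) ((\<lambda>(C, v). (insert v C, v)) a) = a"
        unfolding a(1) by simp
    qed
  qed auto
  then have "card (SIGMA C:cliques V E (Suc n). C) = card (SIGMA C:cliques V E n. ?ext C)"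
    by (rule bij_betw_same_card)
  moreover have "card (SIGMA C:cliques V E (Suc n). C) = (\<Sum>C\<in>cliques V E (Suc n). card C)"
    by (rule card_SigmaI[OF fin]) (auto simp: cliques_def)
  moreover have "card (SIGMA C:cliques V E n. ?ext C) = (\<Sum>C\<in>cliques V E n. card (?ext C))"
    by (rule card_SigmaI[OF fin]) (use V in auto)
  moreover have "(\<Sum>C\<in>cliques V E (Suc n). card C) = (\<Sum>C\<in>cliques V E (Suc n). Suc n)"
    by (rule sum.cong) (auto simp: cliques_def)
  moreover have "(\<Sum>C\<in>cliques V E n. card (?ext C)) = (\<Sum>C\<in>cliques V E n. s)"
    by (rule sum.cong) (use ext in auto)
  ultimately show ?thesis by (simp add: mult.commute)
qed

section \<open>Cliques in the unitary Cayley graph of R/I\<close>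

text \<open>An edge is an unordered pair and may be given with its ends exchanged; the difference
  then changes only by the unit \<open>\<ominus> \<one>\<close>.\<close>

lemma (in cring) unitary_cayley_edge_iff:
  assumes "a \<in> carrier R" "b \<in> carrier R"
  shows "{a, b} \<in> unitary_cayley_edges R \<longleftrightarrow> a \<ominus> b \<in> Units R"
proof
  assume "{a, b} \<in> unitary_cayley_edges R"
  then obtain c d where cd: "{a, b} = {c, d}" "c \<ominus> d \<in> Units R" unfolding unitary_cayley_edges_def by blast
  then consider "a = c" "b = d" | "a = d" "b = c" by (auto simp: doubleton_eq_iff)
  then show "a \<ominus> b \<in> Units R"
  proof cases
    case 2
    have "a \<ominus> b = \<ominus> \<one> \<otimes> (c \<ominus> d)" using assms unfolding 2 by algebra
    moreover have "\<ominus> \<one> \<in> Units R" by (rule Units_minus_one_closed)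
    ultimately show ?thesis using cd(2) Units_m_closed by simp
  qed (use cd in simp)
qed (use assms in \<open>auto simp: unitary_cayley_edges_def\<close>)

lemma (in cring) rcos_Units_iff:
  assumes I: "ideal I R" and z: "z \<in> carrier R"
  shows "I +> z \<in> Units (R Quot I) \<longleftrightarrow> unit_modulo R I z"
proof -
  interpret I: ideal I R by (rule I)
  interpret h: ring_hom_cring R "R Quot I" "(+>) I" by (rule I.rcos_ring_hom_cring[OF is_cring])
  have inv: "(I +> u) \<otimes>\<^bsub>R Quot I\<^esub> (I +> z) = \<one>\<^bsub>R Quot I\<^esub> \<longleftrightarrow> u \<otimes> z \<ominus> \<one> \<in> I" if u: "u \<in> carrier R" for u
    using quotient_eq_iff_same_a_r_cos[OF I, of "u \<otimes> z" \<one>] u z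
    by (simp flip: h.hom_mult h.hom_one)
  show ?thesis
  proof
    assume "I +> z \<in> Units (R Quot I)"
    then obtain U where U: "U \<in> carrier (R Quot I)" "U \<otimes>\<^bsub>R Quot I\<^esub> (I +> z) = \<one>\<^bsub>R Quot I\<^esub>"
      unfolding Units_def by blast
    from U(1) obtain u where "u \<in> carrier R" "U = I +> u" unfolding carrier_Quot by blast
    then show "unit_modulo R I z" unfolding unit_modulo_def using U(2) inv by blast
  next
    assume "unit_modulo R I z"
    then obtain u where u: "u \<in> carrier R" "u \<otimes> z \<ominus> \<one> \<in> I" unfolding unit_modulo_def by blast
    have "(I +> u) \<otimes>\<^bsub>R Quot I\<^esub> (I +> z) = \<one>\<^bsub>R Quot I\<^esub>" using inv u by blast
    moreover have "(I +> z) \<otimes>\<^bsub>R Quot I\<^esub> (I +> u) = (I +> u) \<otimes>\<^bsub>R Quot I\<^esub> (I +> z)"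
      using u z by (intro h.S.m_comm) simp_all
    ultimately show "I +> z \<in> Units (R Quot I)"
      unfolding Units_def using h.hom_closed u z by auto
  qed
qed

lemma (in dedekind_domain) card_clique_extensions:
  assumes I: "ideal I R" "I \<noteq> {\<zero>}" and fin: "finite (carrier (R Quot I))"
    and C: "C \<in> cliques (carrier (R Quot I)) (unitary_cayley_edges (R Quot I)) n"
  shows "card {v \<in> carrier (R Quot I). \<forall>c\<in>C. {v, c} \<in> unitary_cayley_edges (R Quot I)} = schemmel R n I"
proof -
  interpret I: ideal I R by (rule I)
  interpret h: ring_hom_cring R "R Quot I" "(+>) I" by (rule I.rcos_ring_hom_cring[OF is_cring])
  have edge: "{I +> y, I +> t} \<in> unitary_cayley_edges (R Quot I) \<longleftrightarrow> unit_modulo R I (y \<ominus> t)"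
    if "y \<in> carrier R" "t \<in> carrier R" for y t
  proof -
    have "(I +> y) \<ominus>\<^bsub>R Quot I\<^esub> (I +> t) = I +> (y \<ominus> t)" using that by (simp add: a_minus_def)
    then show ?thesis
      using h.S.unitary_cayley_edge_iff[of "I +> y" "I +> t"] rcos_Units_iff[OF I(1), of "y \<ominus> t"] that
      by simp
  qed
  have C': "C \<subseteq> (\<lambda>y. I +> y) ` carrier R" "finite C" "card C = n"
    "pairwise (\<lambda>a b. {a, b} \<in> unitary_cayley_edges (R Quot I)) C"
    using C by (auto simp: cliques_def carrier_Quot)
  \<comment> \<open>One representative in \<open>R\<close> for each vertex of the clique;
    injectivity keeps the cardinality \<open>n\<close>.\<close>
  obtain T where T: "T \<subseteq> carrier R" "C = (\<lambda>y. I +> y) ` T" "inj_on (\<lambda>y. I +> y) T"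
    using subset_image_inj C'(1) by metis
  have finT: "finite T" using C'(2) finite_image_iff[OF T(3)] T(2) by simp
  have cT: "card T = n" using C'(3) card_image[OF T(3)] T(2) by simp
  have pw: "pairwise (\<lambda>t t'. unit_modulo R I (t \<ominus> t')) T"
  proof (rule pairwiseI)
    fix t t' assume t: "t \<in> T" "t' \<in> T" "t \<noteq> t'"
    then have "I +> t \<noteq> I +> t'" using inj_onD[OF T(3)] by blast
    then have "{I +> t, I +> t'} \<in> unitary_cayley_edges (R Quot I)"
      using C'(4) t unfolding T(2) pairwise_def by blast
    then show "unit_modulo R I (t \<ominus> t')" using edge t T(1) by blast
  qed
  let ?N = "card ((\<lambda>y. I +> y) ` {y \<in> carrier R. \<forall>t\<in>T. unit_modulo R I (y \<ominus> t)})"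
  have N: "s = ?N" if "schemmel_rel R n I s" for s
    using card_schemmel_rel[OF that T(1) finT cT pw] by simp
  obtain s where s: "schemmel_rel R n I s" using schemmel_rel_exists[OF I fin] by blast
  \<comment> \<open>The description \<open>THE\<close> is legitimate here: a value exists, and the
    clique \<open>C\<close>, lifted to \<open>T\<close>, forces every value to be
    \<open>?N\<close>.\<close>
  have "schemmel R n I = ?N"
    unfolding schemmel_def by (rule the_equality) (use s N in auto)
  moreover have "{v \<in> carrier (R Quot I). \<forall>c\<in>C. {v, c} \<in> unitary_cayley_edges (R Quot I)}
      = (\<lambda>y. I +> y) ` {y \<in> carrier R. \<forall>t\<in>T. unit_modulo R I (y \<ominus> t)}"
  proof -
    have "{y \<in> carrier R. \<forall>t\<in>T. unit_modulo R I (y \<ominus> t)}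
        = {y \<in> carrier R. \<forall>t\<in>T. {I +> y, I +> t} \<in> unitary_cayley_edges (R Quot I)}"
      using edge T(1) by blast
    then show ?thesis unfolding carrier_Quot T(2) by auto
  qed
  ultimately show ?thesis by simp
qed

theorem theorem3p1:
  fixes R :: "('a, 'm) ring_scheme" (structure) and I :: "'a set" and m :: nat
  assumes "dedekind_domain R"
    and "ideal I R" and "I \<noteq> {\<zero>}"
    and "finite (carrier (R Quot I))"
    and "carrier (R Quot I) \<noteq> {\<zero>\<^bsub>R Quot I\<^esub>}"
    and "m > 0"
  shows "real (card (cliques (carrier (R Quot I)) (unitary_cayley_edges (R Quot I)) m)) =
    (\<Prod>k=1..m. real (schemmel R (k - 1) I) / real k)"
proof -
  interpret dedekind_domain R by fact
  interpret I: ideal I R by fact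
  interpret S: cring "R Quot I" by (rule I.quotient_is_cring[OF is_cring])
  let ?V = "carrier (R Quot I)" and ?E = "unitary_cayley_edges (R Quot I)"
  \<comment> \<open>In the nontrivial ring R/I zero is not a unit, so the graph has no
    loops.\<close>
  have "\<zero>\<^bsub>R Quot I\<^esub> \<notin> Units (R Quot I)"
  proof
    assume "\<zero>\<^bsub>R Quot I\<^esub> \<in> Units (R Quot I)"
    then obtain u where "u \<in> ?V" "u \<otimes>\<^bsub>R Quot I\<^esub> \<zero>\<^bsub>R Quot I\<^esub> = \<one>\<^bsub>R Quot I\<^esub>"
      using S.Units_l_inv_ex by blast
    then have "\<one>\<^bsub>R Quot I\<^esub> = \<zero>\<^bsub>R Quot I\<^esub>" using S.r_null by simp
    then show False using assms(5) S.carrier_one_zero by blast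
  qed
  then have "{v, v} \<notin> ?E" if "v \<in> ?V" for v
    using S.unitary_cayley_edge_iff[OF that that] that by (simp add: S.r_neg a_minus_def)
  then have rec: "Suc n * card (cliques ?V ?E (Suc n)) = card (cliques ?V ?E n) * schemmel R n I" for n
    by (rule card_cliques_Suc[OF assms(4) _ card_clique_extensions[OF assms(2-4)]])
  show ?thesis
  proof (induction m)
    case 0
    \<comment> \<open>The empty set is the only clique of order 0, in agreement with the empty
      product.\<close>
    have "cliques ?V ?E 0 = {{}}" by (auto simp: cliques_def)
    then show ?case by simp
  next
    case (Suc n)
    \<comment> \<open>The new factor is the one for k = n + 1, so its index k - 1 is the order
      \<open>n\<close> of the clique being extended.\<close>
    have "real (card (cliques ?V ?E (Suc n))) = real (card (cliques ?V ?E n)) * (real (schemmel R n I) / real (Suc n))"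
      using arg_cong[OF rec[of n], of real] by (simp add: field_simps)
    then show ?case using Suc by simp
  qed
qed

end
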